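(* Let $w\in S_n$ and let $d=\mathrm{raj}(w)-\mathrm{inv}(w)$. Then for every $0\le i\le d$, the monomial $\mathbf{x}^{L_w(i)}$ appears with nonzero coefficient in the Grothendieck polynomial $\mathfrak{G}_w(x_1,\ldots,x_n)$.
   Context: Grothendieck polynomials. For $j\in[n-1]$, with $s_j$ the adjacent transposition swapping $j$ and $j+1$ (acting on polynomials by exchanging $x_j,x_{j+1}$), let $\partial_j(f)=\frac{f-s_j\cdot f}{x_j-x_{j+1}}$ and $\overline{\partial}_j(f)=\partial_j(f-x_{j+1}f)$ on $\mathbb{Z}[x_1,\ldots,x_n]$. Let $w_0\in S_n$ be the longest permutation, $w_0(k)=n+1-k$. Set $\mathfrak{G}_{w_0}=x_1^{n-1}x_2^{n-2}\cdots x_{n-1}$ and $\mathfrak{G}_w=\overline{\partial}_j\mathfrak{G}_{ws_j}$ whenever $w(j)<w(j+1)$, where $ws_j$ is $w$ with the values in positions $j,j+1$ exchanged. Codes. $\mathrm{invcode}(w)_i=\#\{j>i\mid w(j)<w(i)\}$, $\mathrm{inv}(w)=\sum_i\mathrm{invcode}(w)_i$. $\overline{\mathrm{rajcode}}(w)_i$ is the maximal number $r$ of positions in a sequence $i=\alpha_1<\cdots<\alpha_r\le n$ with $w(\alpha_1)<\cdots<w(\alpha_r)$, minus one. $\mathrm{rajcode}(w)_k=n-k-\overline{\mathrm{rajcode}}(w)_k$ and $\mathrm{raj}(w)=\sum_k\mathrm{rajcode}(w)_k$. One has $\mathrm{rajcode}(w)_k\ge\mathrm{invcode}(w)_k$ for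 all $k$. The vectors $L_w(0),\ldots,L_w(d)$: set $L_w(0)=\mathrm{invcode}(w)$; for $1\le i\le d$ let $j\in[n]$ be the largest index with $L_w(i-1)_j<\mathrm{rajcode}(w)_j$ and set $L_w(i)=L_w(i-1)+e_j$, with $e_j$ the $j$th standard basis vector. $\mathbf{x}^v=\prod_kx_k^{v_k}$. *)

theory Defs
  imports "HOL-Library.Poly_Mapping" "HOL-Combinatorics.Permutations"
begin

section \<open>Polynomials and divided differences\<close>

text \<open>
  Integer polynomials in the variables \<open>X 1, X 2, \<dots>\<close> are finitely supported maps from exponent
  vectors to coefficients, so that the coefficient of the monomial with exponent vector \<open>m\<close> in
  \<open>f\<close> is \<open>Poly_Mapping.lookup f m\<close>.  The ring \<open>\<int>[x\<^sub>1,\<dots>,x\<^sub>n]\<close> is the subring of polynomials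
  involving only \<open>X 1, \<dots>, X n\<close>; all polynomials constructed below lie in it.
\<close>

type_synonym zpoly = "(nat \<Rightarrow>\<^sub>0 nat) \<Rightarrow>\<^sub>0 int"

definition X :: "nat \<Rightarrow> zpoly" where
  "X k = Poly_Mapping.single (Poly_Mapping.single k 1) 1"

text \<open>The exponent vector \<open>(v 1, \<dots>, v n)\<close>; values of \<open>v\<close> outside \<open>{1..n}\<close> are ignored.\<close>

definition expvec :: "nat \<Rightarrow> (nat \<Rightarrow> nat) \<Rightarrow> nat \<Rightarrow>\<^sub>0 nat" where
  "expvec n v = (\<Sum>k=1..n. Poly_Mapping.single k (v k))"

text \<open>The adjacent transposition exchanging the variables \<open>X j\<close> and \<open>X (j + 1)\<close>; see
  \<open>act_X\<close> and \<open>act_mult\<close> below.\<close>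

definition act :: "nat \<Rightarrow> zpoly \<Rightarrow> zpoly" where
  "act j f = Poly_Mapping.map_key (Poly_Mapping.map_key (transpose j (Suc j))) f"

text \<open>The quotient \<open>(f - s\<^sub>j f) / (x\<^sub>j - x\<^sub>j\<^sub>+\<^sub>1)\<close>; it exists and is unique by \<open>divdiff_ex1\<close> below.\<close>

definition divdiff :: "nat \<Rightarrow> zpoly \<Rightarrow> zpoly" where
  "divdiff j f = (THE g. g * (X j - X (Suc j)) = f - act j f)"

definition idivdiff :: "nat \<Rightarrow> zpoly \<Rightarrow> zpoly" where
  "idivdiff j f = divdiff j (f - X (Suc j) * f)"


section \<open>Grothendieck polynomials\<close>

text \<open>Elements of \<open>S\<^sub>n\<close> are functions \<open>w\<close> with \<open>w permutes {1..n}\<close>.\<close>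

definition longest :: "nat \<Rightarrow> nat \<Rightarrow> nat" where
  "longest n k = (if k \<in> {1..n} then n + 1 - k else k)"

text \<open>
  All polynomials that the recursion yields for \<open>w\<close>, over all choices of ascents.  Theorem
  \<open>groth_rel_ex1\<close> below shows that there is exactly one, so the Grothendieck polynomial is
  well defined.
\<close>

inductive groth_rel :: "nat \<Rightarrow> (nat \<Rightarrow> nat) \<Rightarrow> zpoly \<Rightarrow> bool" for n where
  longest: "groth_rel n (longest n) (\<Prod>k=1..n. X k ^ (n - k))"
| ascent: "\<lbrakk>w permutes {1..n}; j \<in> {1..<n}; w j < w (Suc j);
     groth_rel n (w \<circ> transpose j (Suc j)) f\<rbrakk> \<Longrightarrow> groth_rel n w (idivdiff j f)"

definition grothendieck :: "nat \<Rightarrow> (nat \<Rightarrow> nat) \<Rightarrow> zpoly" where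
  "grothendieck n w = (THE f. groth_rel n w f)"


section \<open>Codes\<close>

definition invcode :: "nat \<Rightarrow> (nat \<Rightarrow> nat) \<Rightarrow> nat \<Rightarrow> nat" where
  "invcode n w i = card {j \<in> {i<..n}. w j < w i}"

definition inv_number :: "nat \<Rightarrow> (nat \<Rightarrow> nat) \<Rightarrow> nat" where
  "inv_number n w = (\<Sum>i=1..n. invcode n w i)"

definition inc_seqs :: "nat \<Rightarrow> (nat \<Rightarrow> nat) \<Rightarrow> nat \<Rightarrow> nat list set" where
  "inc_seqs n w i = {\<alpha>. \<alpha> \<noteq> [] \<and> hd \<alpha> = i \<and> last \<alpha> \<le> n \<and>
     sorted_wrt (<) \<alpha> \<and> sorted_wrt (<) (map w \<alpha>)}"

definition rajcode_bar :: "nat \<Rightarrow> (nat \<Rightarrow> nat) \<Rightarrow> nat \<Rightarrow> nat" where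
  "rajcode_bar n w i = Max (length ` inc_seqs n w i) - 1"

text \<open>None of the subtractions truncates for \<open>k \<in> {1..n}\<close>; see \<open>invcode_le_rajcode\<close> below.
  Likewise \<open>raj n w - inv_number n w\<close> does not truncate, by \<open>inv_number_le_raj\<close>.\<close>

definition rajcode :: "nat \<Rightarrow> (nat \<Rightarrow> nat) \<Rightarrow> nat \<Rightarrow> nat" where
  "rajcode n w k = n - k - rajcode_bar n w k"

definition raj :: "nat \<Rightarrow> (nat \<Rightarrow> nat) \<Rightarrow> nat" where
  "raj n w = (\<Sum>k=1..n. rajcode n w k)"

text \<open>The index set in the recursion is nonempty for every step \<open>i < raj n w - inv_number n w\<close>.\<close>

primrec L :: "nat \<Rightarrow> (nat \<Rightarrow> nat) \<Rightarrow> nat \<Rightarrow> nat \<Rightarrow> nat" where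
  "L n w 0 = invcode n w"
| "L n w (Suc i) = (let j = Max {j \<in> {1..n}. L n w i j < rajcode n w j}
     in (L n w i)(j := L n w i j + 1))"


section \<open>Well-definedness\<close>

subsection \<open>Codes\<close>

lemma inc_seqs_bound:
  assumes "\<alpha> \<in> inc_seqs n w i"
  shows "length \<alpha> + invcode n w i \<le> Suc (n - i)" "i \<le> n" "set \<alpha> \<subseteq> {i..n}"
proof -
  from assms have a: "\<alpha> \<noteq> []" "hd \<alpha> = i" "last \<alpha> \<le> n" "sorted_wrt (<) \<alpha>"
    "sorted_wrt (<) (map w \<alpha>)" by (auto simp: inc_seqs_def)
  then obtain \<beta> where \<beta>: "\<alpha> = i # \<beta>" by (cases \<alpha>) auto
  have "\<forall>x\<in>set \<alpha>. x \<le> last \<alpha>"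
  proof -
    have "sorted_wrt (<) (butlast \<alpha> @ [last \<alpha>])" using a by simp
    then have "\<forall>x\<in>set (butlast \<alpha>). x < last \<alpha>" by (simp only: sorted_wrt_append) auto
    moreover have "set \<alpha> = set (butlast \<alpha> @ [last \<alpha>])" using a(1) by simp
    ultimately show ?thesis by auto
  qed
  moreover have "\<forall>x\<in>set \<alpha>. i \<le> x" using a(4) by (auto simp: \<beta>)
  ultimately show sub: "set \<alpha> \<subseteq> {i..n}" using a(3) by auto
  show i: "i \<le> n" using sub \<beta> by auto
  let ?I = "{j \<in> {i<..n}. w j < w i}"
  have "\<forall>x\<in>set \<beta>. i < x" "\<forall>x\<in>set \<beta>. w i < w x" using a(4,5) by (auto simp: \<beta>)
  with sub have s: "set \<beta> \<subseteq> {i<..n}" "set \<beta> \<inter> ?I = {}" by (auto simp: \<beta>)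
  have d: "distinct \<beta>" using a(4) \<beta> by (simp add: strict_sorted_iff)
  have "length \<beta> + card ?I = card (set \<beta> \<union> ?I)"
    using s d by (subst card_Un_disjoint) (auto simp: distinct_card)
  also have "\<dots> \<le> card {i<..n}" using s by (intro card_mono) auto
  finally show "length \<alpha> + invcode n w i \<le> Suc (n - i)" by (simp add: \<beta> invcode_def)
qed

lemma finite_inc_seqs: "finite (inc_seqs n w i)"
proof (rule finite_subset)
  show "inc_seqs n w i \<subseteq> {\<alpha>. set \<alpha> \<subseteq> {i..n} \<and> length \<alpha> \<le> Suc n}"
  proof
    fix \<alpha> assume "\<alpha> \<in> inc_seqs n w i"
    from inc_seqs_bound[OF this] show "\<alpha> \<in> {\<alpha>. set \<alpha> \<subseteq> {i..n} \<and> length \<alpha> \<le> Suc n}" by auto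
  qed
qed (rule finite_lists_length_le, simp)

lemma invcode_le_rajcode:
  assumes "k \<in> {1..n}"
  shows "length ` inc_seqs n w k \<noteq> {}" "Max (length ` inc_seqs n w k) \<ge> 1"
    "rajcode_bar n w k \<le> n - k" "invcode n w k \<le> rajcode n w k"
proof -
  let ?S = "length ` inc_seqs n w k"
  have k: "[k] \<in> inc_seqs n w k" using assms by (auto simp: inc_seqs_def)
  have fin: "finite ?S" by (simp add: finite_inc_seqs)
  show ne: "?S \<noteq> {}" using k by auto
  have "length [k] \<in> ?S" using k by blast
  then show ge: "Max ?S \<ge> 1" using fin by (intro Max_ge) auto
  obtain \<alpha> where "\<alpha> \<in> inc_seqs n w k" "Max ?S = length \<alpha>" using Max_in[OF fin ne] by auto
  with inc_seqs_bound(1)[of \<alpha> n w k] have "Max ?S + invcode n w k \<le> Suc (n - k)" by simp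
  with ge show "rajcode_bar n w k \<le> n - k" "invcode n w k \<le> rajcode n w k"
    by (simp_all add: rajcode_def rajcode_bar_def)
qed

lemma inv_number_le_raj: "inv_number n w \<le> raj n w"
  unfolding inv_number_def raj_def by (intro sum_mono invcode_le_rajcode)


subsection \<open>The action of adjacent transpositions on polynomials\<close>

lemma poly_mapping_induct_add [case_names zero single add]:
  assumes "P 0" "\<And>m c. P (Poly_Mapping.single m c)" "\<And>f g. P f \<Longrightarrow> P g \<Longrightarrow> P (f + g)"
  shows "P (f :: 'a \<Rightarrow>\<^sub>0 'b::comm_monoid_add)"
proof (induction f rule: update_induct)
  case const
  then show ?case by (rule assms)
next
  case (update f a b)
  have "Poly_Mapping.update a b f = f + Poly_Mapping.single a b"
    using update(1) by (intro poly_mapping_eqI)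
      (auto simp: lookup_update lookup_add lookup_single when_def in_keys_iff)
  with update assms show ?case by auto
qed

lemma zpoly_induct [case_names const var add mult]:
  assumes const: "\<And>c. P (Poly_Mapping.single 0 c)" and var: "\<And>k. P (X k)"
    and add: "\<And>f g. P f \<Longrightarrow> P g \<Longrightarrow> P (f + g)" and mult: "\<And>f g. P f \<Longrightarrow> P g \<Longrightarrow> P (f * g)"
  shows "P f"
proof (induction f rule: poly_mapping_induct_add)
  case zero
  then show ?case using const[of 0] by simp
next
  case (single m c)
  have p: "P (Poly_Mapping.single (Poly_Mapping.single k v) 1)" for k v
  proof (induction v)
    case 0
    then show ?case using const[of 1] by simp
  next
    case (Suc v)
    have "Poly_Mapping.single (Poly_Mapping.single k (Suc v)) 1 =
        Poly_Mapping.single (Poly_Mapping.single k v) 1 * X k"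
      by (simp add: X_def mult_single flip: single_add)
    with Suc mult var show ?case by simp
  qed
  show ?case
  proof (induction m arbitrary: c rule: poly_mapping_induct_add)
    case (single k v)
    have "Poly_Mapping.single (Poly_Mapping.single k v) c =
        Poly_Mapping.single 0 c * Poly_Mapping.single (Poly_Mapping.single k v) 1"
      by (simp add: mult_single)
    with p const mult show ?case by simp
  next
    case (add m m')
    have "Poly_Mapping.single (m + m') c = Poly_Mapping.single m c * Poly_Mapping.single m' 1"
      by (simp add: mult_single)
    with add mult show ?case by simp
  qed (simp add: const)
qed (rule add)

abbreviation exp_act :: "nat \<Rightarrow> (nat \<Rightarrow>\<^sub>0 nat) \<Rightarrow> nat \<Rightarrow>\<^sub>0 nat" where
  "exp_act j \<equiv> Poly_Mapping.map_key (transpose j (Suc j))"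

lemma exp_act_exp_act: "exp_act j (exp_act j m) = m"
  by (intro poly_mapping_eqI) (simp add: map_key.rep_eq)

lemma inj_exp_act: "inj (exp_act j)"
  by (metis exp_act_exp_act injI)

lemma act_single: "act j (Poly_Mapping.single m c) = Poly_Mapping.single (exp_act j m) c"
  unfolding act_def using map_key_single[OF inj_exp_act, of j "exp_act j m" c]
  by (simp add: exp_act_exp_act)

lemma act_const [simp]: "act j (Poly_Mapping.single 0 c) = Poly_Mapping.single 0 c"
  by (simp add: act_single)

lemma act_0 [simp]: "act j 0 = 0"
  using act_const[of j 0] by simp

lemma act_1 [simp]: "act j 1 = 1"
  using act_const[of j 1] by simp

lemma act_add [simp]: "act j (f + g) = act j f + act j g"
  unfolding act_def by (rule map_key_plus) (rule inj_exp_act)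

lemma act_diff [simp]: "act j (f - g) = act j f - act j g"
  by (metis act_add add_diff_cancel_right' diff_add_cancel)

lemma act_mult [simp]: "act j (f * g) = act j f * act j g"
proof (induction f rule: poly_mapping_induct_add)
  case (single m c)
  show ?case
    by (induction g rule: poly_mapping_induct_add)
      (simp_all add: act_single mult_single map_key_plus distrib_left)
qed (simp_all add: distrib_right)

lemma act_X [simp]: "act j (X k) = X (transpose j (Suc j) k)"
proof -
  have "exp_act j (Poly_Mapping.single k 1) = Poly_Mapping.single (transpose j (Suc j) k) 1"
    using map_key_single[of "transpose j (Suc j)" "transpose j (Suc j) k" "1::nat"] by simp
  then show ?thesis by (simp add: X_def act_single)
qed

lemma act_act [simp]: "act j (act j f) = f"
  by (induction f rule: poly_mapping_induct_add) (simp_all add: act_single exp_act_exp_act)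

lemma act_commute:
  assumes "j \<noteq> k" "Suc j \<noteq> k" "j \<noteq> Suc k"
  shows "act j (act k f) = act k (act j f)"
  by (induction f rule: zpoly_induct) (use assms in \<open>auto simp: transpose_def\<close>)

lemma act_braid: "act j (act (Suc j) (act j f)) = act (Suc j) (act j (act (Suc j) f))"
  by (induction f rule: zpoly_induct) (auto simp: transpose_def)

lemma X_eq_iff: "X j = X k \<longleftrightarrow> j = k"
  unfolding X_def by (metis lookup_single_eq lookup_single_not_eq zero_neq_one)


subsection \<open>Divided differences\<close>

lemma divdiff_dvd: "X j - X (Suc j) dvd f - act j f"
proof (induction f rule: zpoly_induct)
  case (var k)
  consider "k = j" | "k = Suc j" | "k \<noteq> j" "k \<noteq> Suc j" by auto
  then show ?case
  proof cases
    case 2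
    have "X j - X (Suc j) dvd - (X j - X (Suc j))" by (simp only: dvd_minus_iff dvd_refl)
    then show ?thesis by (simp add: 2)
  qed simp_all
next
  case (add f g)
  have "f + g - act j (f + g) = (f - act j f) + (g - act j g)" by simp
  with add show ?case by (metis dvd_add)
next
  case (mult f g)
  have "f * g - act j (f * g) = (f - act j f) * g + act j f * (g - act j g)"
    by (simp add: algebra_simps)
  with mult show ?case by (metis dvd_add dvd_mult dvd_mult2)
qed simp

lemma divdiff_ex1: "\<exists>!g. g * (X j - X (Suc j)) = f - act j f"
proof (rule ex_ex1I)
  show "\<exists>g. g * (X j - X (Suc j)) = f - act j f"
    using divdiff_dvd[of j f] by (metis dvdE mult.commute)
  show "g = h" if "g * (X j - X (Suc j)) = f - act j f" "h * (X j - X (Suc j)) = f - act j f" for g h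
    using that X_eq_iff[of j "Suc j"] by (metis mult_right_cancel n_not_Suc_n right_minus_eq)
qed

lemma divdiff: "divdiff j f * (X j - X (Suc j)) = f - act j f"
  unfolding divdiff_def by (rule theI') (rule divdiff_ex1)

lemma idivdiff:
  "idivdiff j f * (X j - X (Suc j)) = (1 - X (Suc j)) * f - (1 - X j) * act j f"
  unfolding idivdiff_def divdiff by (simp add: algebra_simps)

lemma X_diff_nonzero: "j \<noteq> k \<Longrightarrow> X j - X k \<noteq> 0"
  by (simp add: X_eq_iff)

lemma act_idivdiff: "act j (idivdiff j f) = idivdiff j f"
proof -
  have "act j (idivdiff j f) * (X (Suc j) - X j) = (1 - X j) * act j f - (1 - X (Suc j)) * f"
    using arg_cong[OF idivdiff[of j f], of "act j"] by simp
  then have "act j (idivdiff j f) * (X j - X (Suc j)) = idivdiff j f * (X j - X (Suc j))"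
    unfolding idivdiff by (simp add: algebra_simps)
  then show ?thesis using X_diff_nonzero[of j "Suc j"] by simp
qed

lemma idivdiff_commute:
  assumes "j \<noteq> k" "Suc j \<noteq> k" "j \<noteq> Suc k"
  shows "idivdiff j (idivdiff k f) = idivdiff k (idivdiff j f)"
proof -
  define a b c d where "a = X j" and "b = X (Suc j)" and "c = X k" and "d = X (Suc k)"
  have t: "transpose j (Suc j) k = k" "transpose j (Suc j) (Suc k) = Suc k"
    "transpose k (Suc k) j = j" "transpose k (Suc k) (Suc j) = Suc j"
    using assms by (auto simp: transpose_def)
  have 1: "idivdiff j (idivdiff k f) * (a - b) =
      (1 - b) * idivdiff k f - (1 - a) * act j (idivdiff k f)"
    unfolding a_def b_def by (rule idivdiff)
  have 2: "idivdiff k f * (c - d) = (1 - d) * f - (1 - c) * act k f"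
    unfolding c_def d_def by (rule idivdiff)
  have 3: "act j (idivdiff k f) * (c - d) = (1 - d) * act j f - (1 - c) * act j (act k f)"
    using arg_cong[OF 2, of "act j"] by (simp add: c_def d_def t)
  have 4: "idivdiff k (idivdiff j f) * (c - d) =
      (1 - d) * idivdiff j f - (1 - c) * act k (idivdiff j f)"
    unfolding c_def d_def by (rule idivdiff)
  have 5: "idivdiff j f * (a - b) = (1 - b) * f - (1 - a) * act j f"
    unfolding a_def b_def by (rule idivdiff)
  have 6: "act k (idivdiff j f) * (a - b) = (1 - b) * act k f - (1 - a) * act j (act k f)"
    using arg_cong[OF 5, of "act k"] by (simp add: a_def b_def t act_commute[OF assms])
  have "idivdiff j (idivdiff k f) * ((a - b) * (c - d)) =
      (1 - b) * (idivdiff k f * (c - d)) - (1 - a) * (act j (idivdiff k f) * (c - d))"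
    by (simp only: mult.assoc[symmetric] 1) (simp only: left_diff_distrib mult.assoc)
  also have "\<dots> = (1 - d) * (idivdiff j f * (a - b)) - (1 - c) * (act k (idivdiff j f) * (a - b))"
    unfolding 2 3 5 6 by (simp add: algebra_simps)
  also have "\<dots> = (idivdiff k (idivdiff j f) * (c - d)) * (a - b)"
    unfolding 4 by (simp only: left_diff_distrib mult.assoc)
  also have "\<dots> = idivdiff k (idivdiff j f) * ((a - b) * (c - d))"
    by (simp only: mult_ac)
  finally have "idivdiff j (idivdiff k f) * ((a - b) * (c - d)) =
      idivdiff k (idivdiff j f) * ((a - b) * (c - d))" .
  moreover have "(a - b) * (c - d) \<noteq> 0"
    unfolding a_def b_def c_def d_def by (simp add: X_eq_iff)
  ultimately show ?thesis by (metis mult_right_cancel)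
qed

lemma
  fixes A B C p q x1 x2 x3 x4 x5 x6 :: "'a::comm_ring_1"
  shows ring_id0: "(p * x1 - q * x2) * (x3 * x4) = p * x3 * (x1 * x4) - q * x4 * (x2 * x3)"
  and ring_id'': "B * C * (C * x1 - B * x2) - A * C * (C * x3 - A * x4) + A * B * (B * x5 - A * x6) =
    C^2 * (B * x1 - A * x3) - B^2 * (C * x2 - A * x5) + A^2 * (C * x4 - B * x6)"
  by (simp_all add: algebra_simps power2_eq_square)

lemma one_minus: "(1 - x) - (1 - y) = y - (x :: 'a::comm_ring_1)"
  by simp

lemma ring_id:
  fixes a b c :: "'a::comm_ring_1"
  shows "(1 - b) * (a - c) * ((1 - c) * g - (1 - b) * p) -
      (1 - a) * (b - c) * ((1 - c) * g - (1 - a) * q) =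
    (1 - c)^2 * (g * (a - b)) - (1 - b)^2 * (p * (a - c)) + (1 - a)^2 * (q * (b - c))"
proof -
  have "B * (C - A) * (C * g - B * p) - A * (C - B) * (C * g - A * q) =
    C^2 * (g * (B - A)) - B^2 * (p * (C - A)) + A^2 * (q * (C - B))" for A B C
    by (simp add: algebra_simps power2_eq_square)
  from this[of "1 - b" "1 - c" "1 - a"] show ?thesis by (simp only: one_minus)
qed

lemma ring_id':
  fixes a b c :: "'a::comm_ring_1"
  shows "(1 - c) * (a - c) * ((1 - b) * g - (1 - a) * p) -
      (1 - b) * (a - b) * ((1 - c) * g - (1 - a) * q) =
    (1 - b) * (1 - c) * (g * (b - c)) - (1 - a) * (1 - c) * (p * (a - c))
      + (1 - a) * (1 - b) * (q * (a - b))"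
proof -
  have "C * (C - A) * (B * g - A * p) - B * (B - A) * (C * g - A * q) =
    B * C * (g * (C - B)) - A * C * (p * (C - A)) + A * B * (q * (B - A))" for A B C
    by (simp add: algebra_simps)
  from this[of "1 - c" "1 - a" "1 - b"] show ?thesis by (simp only: one_minus)
qed

lemma idivdiff_braid:
  "idivdiff j (idivdiff (Suc j) (idivdiff j f)) =
   idivdiff (Suc j) (idivdiff j (idivdiff (Suc j) f))"
proof -
  define a b c where "a = X j" and "b = X (Suc j)" and "c = X (Suc (Suc j))"
  define s t where "s = act j" and "t = act (Suc j)"
  have X: "s a = b" "s b = a" "s c = c" "t a = a" "t b = c" "t c = b"
    by (simp_all add: a_def b_def c_def s_def t_def transpose_def)
  have hom: "s (p + q) = s p + s q" "s (p - q) = s p - s q" "s (p * q) = s p * s q" "s 1 = 1"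
    "t (p + q) = t p + t q" "t (p - q) = t p - t q" "t (p * q) = t p * t q" "t 1 = 1" for p q
    by (simp_all add: s_def t_def)
  have D: "idivdiff j p * (a - b) = (1 - b) * p - (1 - a) * s p"
    "idivdiff (Suc j) p * (b - c) = (1 - c) * p - (1 - b) * t p" for p
    unfolding a_def b_def c_def s_def t_def by (rule idivdiff)+
  have inv: "s (idivdiff j p) = idivdiff j p" "t (idivdiff (Suc j) p) = idivdiff (Suc j) p" for p
    unfolding s_def t_def by (rule act_idivdiff)+
  have br: "t (s (t f)) = s (t (s f))"
    unfolding s_def t_def by (rule act_braid[symmetric])

  define g h k where "g = idivdiff j f" and "h = idivdiff (Suc j) g" and "k = idivdiff j h"
  have g: "g * (a - b) = (1 - b) * f - (1 - a) * s f" unfolding g_def by (rule D)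
  have tg: "t g * (a - c) = (1 - c) * t f - (1 - a) * t (s f)"
    using arg_cong[OF g, of t] by (simp add: hom X)
  have stg: "s (t g) * (b - c) = (1 - c) * s (t f) - (1 - b) * s (t (s f))"
    using arg_cong[OF tg, of s] by (simp add: hom X)
  have h: "h * (b - c) = (1 - c) * g - (1 - b) * t g" unfolding h_def by (rule D)
  have sh: "s h * (a - c) = (1 - c) * g - (1 - a) * s (t g)"
    using arg_cong[OF h, of s] by (simp add: hom X g_def inv)
  have k: "k * (a - b) = (1 - b) * h - (1 - a) * s h" unfolding k_def by (rule D)
  define \<Delta> where "\<Delta> = (a - b) * (a - c) * (b - c)"
  define F where "F = (1 - c)^2 * ((1 - b) * f - (1 - a) * s f)
    - (1 - b)^2 * ((1 - c) * t f - (1 - a) * t (s f))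
    + (1 - a)^2 * ((1 - c) * s (t f) - (1 - b) * s (t (s f)))"
  have "k * \<Delta> = (k * (a - b)) * ((a - c) * (b - c))"
    unfolding \<Delta>_def by (simp only: mult.assoc)
  also have "\<dots> = (1 - b) * (a - c) * (h * (b - c)) - (1 - a) * (b - c) * (s h * (a - c))"
    unfolding k by (rule ring_id0)
  also have "\<dots> = (1 - c)^2 * (g * (a - b)) - (1 - b)^2 * (t g * (a - c))
      + (1 - a)^2 * (s (t g) * (b - c))"
    unfolding h sh by (rule ring_id)
  also have "\<dots> = F" unfolding F_def g tg stg ..
  finally have 1: "k * \<Delta> = F" .

  define g' h' k' where "g' = idivdiff (Suc j) f" and "h' = idivdiff j g'"
    and "k' = idivdiff (Suc j) h'"
  have g': "g' * (b - c) = (1 - c) * f - (1 - b) * t f" unfolding g'_def by (rule D)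
  have sg: "s g' * (a - c) = (1 - c) * s f - (1 - a) * s (t f)"
    using arg_cong[OF g', of s] by (simp add: hom X)
  have tsg: "t (s g') * (a - b) = (1 - b) * t (s f) - (1 - a) * s (t (s f))"
    using arg_cong[OF sg, of t] by (simp add: hom X br)
  have h': "h' * (a - b) = (1 - b) * g' - (1 - a) * s g'" unfolding h'_def by (rule D)
  have th: "t h' * (a - c) = (1 - c) * g' - (1 - a) * t (s g')"
    using arg_cong[OF h', of t] by (simp add: hom X g'_def inv)
  have k': "k' * (b - c) = (1 - c) * h' - (1 - b) * t h'" unfolding k'_def by (rule D)
  have "k' * \<Delta> = (k' * (b - c)) * ((a - c) * (a - b))"
    unfolding \<Delta>_def by (simp only: mult_ac)
  also have "\<dots> = (1 - c) * (a - c) * (h' * (a - b)) - (1 - b) * (a - b) * (t h' * (a - c))"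
    unfolding k' by (rule ring_id0)
  also have "\<dots> = (1 - b) * (1 - c) * (g' * (b - c)) - (1 - a) * (1 - c) * (s g' * (a - c))
      + (1 - a) * (1 - b) * (t (s g') * (a - b))"
    unfolding h' th by (rule ring_id')
  also have "\<dots> = F" unfolding F_def g' sg tsg by (rule ring_id'')
  finally have 2: "k' * \<Delta> = F" .
  have "\<Delta> \<noteq> 0" by (simp add: \<Delta>_def a_def b_def c_def X_eq_iff)
  with 1 2 have "k = k'" by (metis mult_right_cancel)
  then show ?thesis by (simp add: k_def h_def g_def k'_def h'_def g'_def)
qed


subsection \<open>Grothendieck polynomials\<close>

lemma longest_permutes: "longest n permutes {1..n}"
proof (rule bij_imp_permutes)
  show "bij_betw (longest n) {1..n} {1..n}"
    by (rule bij_betw_byWitness[where f' = "longest n"]) (auto simp: longest_def)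
qed (auto simp: longest_def)

lemma permutes_swap:
  assumes "w permutes {1..n}" "j \<in> {1..<n}"
  shows "w \<circ> transpose j (Suc j) permutes {1..n}"
  using assms by (intro permutes_compose permutes_swap_id) auto

lemma no_ascent_longest:
  assumes w: "w permutes {1..n}" and na: "\<And>j. j \<in> {1..<n} \<Longrightarrow> \<not> w j < w (Suc j)"
  shows "w = longest n"
proof
  fix k
  have img: "w i \<in> {1..n}" if "i \<in> {1..n}" for i using permutes_in_image[OF w] that by blast
  have dec: "w (Suc j) < w j" if "j \<in> {1..<n}" for j
    using na[OF that] permutes_inj[OF w] by (metis injD linorder_neqE_nat n_not_Suc_n)
  have le: "w i + i \<le> Suc n" if "1 \<le> i" "i \<le> n" for i
    using that
  proof (induction i rule: dec_induct)
    case base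
    then show ?case using img[of 1] by simp
  next
    case (step i)
    then show ?case using dec[of i] by simp
  qed
  have ge: "Suc n \<le> w i + i" if "i \<le> n" "1 \<le> i" for i
    using that
  proof (induction i rule: inc_induct)
    case base
    then show ?case using img[of n] by simp
  next
    case (step i)
    then show ?case using dec[of i] by simp
  qed
  show "w k = longest n k"
  proof (cases "k \<in> {1..n}")
    case True
    then show ?thesis using le[of k] ge[of k] by (simp add: longest_def)
  next
    case False
    then show ?thesis using permutes_not_in[OF w False] by (auto simp: longest_def)
  qed
qed

text \<open>A measure that decreases along the recursion.\<close>

definition height :: "nat \<Rightarrow> (nat \<Rightarrow> nat) \<Rightarrow> nat" where
  "height n w = (\<Sum>i=1..n. i * w i)"

lemma height_swap:
  assumes j: "j \<in> {1..<n}" and "w j < w (Suc j)"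
  shows "height n (w \<circ> transpose j (Suc j)) < height n w"
proof -
  let ?R = "{1..n} - {j, Suc j}"
  have split: "height n v = (\<Sum>i\<in>?R. i * v i) + (j * v j + Suc j * v (Suc j))" for v
  proof -
    have "height n v = (\<Sum>i\<in>?R. i * v i) + (\<Sum>i\<in>{j, Suc j}. i * v i)"
      unfolding height_def using j by (intro sum.subset_diff) auto
    then show ?thesis by simp
  qed
  have "(\<Sum>i\<in>?R. i * (w \<circ> transpose j (Suc j)) i) = (\<Sum>i\<in>?R. i * w i)"
    by (intro sum.cong) (auto simp: transpose_def)
  with assms show ?thesis by (simp add: split)
qed

lemma groth_rel_permutes: "groth_rel n w f \<Longrightarrow> w permutes {1..n}"
  by (induction rule: groth_rel.induct) (simp_all only: longest_permutes)

lemma groth_rel_exists: "w permutes {1..n} \<Longrightarrow> \<exists>f. groth_rel n w f"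
proof (induction "height n w" arbitrary: w rule: less_induct)
  case less
  show ?case
  proof (cases "\<exists>j \<in> {1..<n}. w j < w (Suc j)")
    case True
    then obtain j where j: "j \<in> {1..<n}" "w j < w (Suc j)" by blast
    from less(1)[OF height_swap[OF j] permutes_swap[OF less(2) j(1)]]
    show ?thesis using groth_rel.ascent[OF less(2) j] by blast
  next
    case False
    then have "w = longest n" using no_ascent_longest[OF less(2)] by blast
    then show ?thesis using groth_rel.longest by blast
  qed
qed

lemma groth_rel_confluent:
  assumes w: "w permutes {1..n}"
    and j: "j \<in> {1..<n}" "w j < w (Suc j)" and k: "k \<in> {1..<n}" "w k < w (Suc k)"
    and "j < k"
  obtains f g where "groth_rel n (w \<circ> transpose j (Suc j)) f"
    "groth_rel n (w \<circ> transpose k (Suc k)) g" "idivdiff j f = idivdiff k g"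
proof -
  let ?wj = "w \<circ> transpose j (Suc j)" and ?wk = "w \<circ> transpose k (Suc k)"
  note perm = permutes_swap[OF w j(1)] permutes_swap[OF w k(1)]
  show ?thesis
  proof (cases "k = Suc j")
    case False
    let ?u = "?wj \<circ> transpose k (Suc k)"
    have u: "?u = ?wk \<circ> transpose j (Suc j)"
      using False \<open>j < k\<close> by (auto simp: fun_eq_iff transpose_def)
    obtain f where f: "groth_rel n ?u f"
      using groth_rel_exists permutes_swap[OF perm(1) k(1)] by blast
    show ?thesis
    proof (rule that)
      show "groth_rel n ?wj (idivdiff k f)"
        using f False \<open>j < k\<close> k by (intro groth_rel.ascent perm) (auto simp: transpose_def)
      show "groth_rel n ?wk (idivdiff j f)"
        using f False \<open>j < k\<close> j unfolding u
        by (intro groth_rel.ascent perm) (auto simp: transpose_def)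
      show "idivdiff j (idivdiff k f) = idivdiff k (idivdiff j f)"
        using False \<open>j < k\<close> by (intro idivdiff_commute) auto
    qed
  next
    case True
    let ?wjk = "?wj \<circ> transpose k (Suc k)" and ?wkj = "?wk \<circ> transpose j (Suc j)"
    let ?u = "?wjk \<circ> transpose j (Suc j)"
    have u: "?u = ?wkj \<circ> transpose k (Suc k)"
      using True by (auto simp: fun_eq_iff transpose_def)
    note perm = perm permutes_swap[OF perm(1) k(1)] permutes_swap[OF perm(2) j(1)]
    obtain f where f: "groth_rel n ?u f"
      using groth_rel_exists permutes_swap[OF perm(3) j(1)] by blast
    show ?thesis
    proof (rule that)
      show "groth_rel n ?wj (idivdiff k (idivdiff j f))"
        using f True j k by (intro groth_rel.ascent perm) (auto simp: transpose_def)
      show "groth_rel n ?wk (idivdiff j (idivdiff k f))"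
        using f True j k unfolding u
        by (intro groth_rel.ascent perm) (auto simp: transpose_def)
      show "idivdiff j (idivdiff k (idivdiff j f)) = idivdiff k (idivdiff j (idivdiff k f))"
        using True by (simp add: idivdiff_braid)
    qed
  qed
qed

lemma groth_rel_ascentE:
  assumes "groth_rel n w f" "w \<noteq> longest n"
  obtains j f' where "j \<in> {1..<n}" "w j < w (Suc j)"
    "f = idivdiff j f'" "groth_rel n (w \<circ> transpose j (Suc j)) f'"
  using assms(1)
proof (cases rule: groth_rel.cases)
  case longest
  with assms(2) show ?thesis by simp
next
  case (ascent j f')
  then show ?thesis by (intro that)
qed

lemma groth_rel_unique: "groth_rel n w f \<Longrightarrow> groth_rel n w g \<Longrightarrow> f = g"
proof (induction "height n w" arbitrary: w f g rule: less_induct)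
  case less
  have w: "w permutes {1..n}" using less(2) by (rule groth_rel_permutes)
  show ?case
  proof (cases "\<exists>j \<in> {1..<n}. w j < w (Suc j)")
    case False
    have "h = (\<Prod>k=1..n. X k ^ (n - k))" if "groth_rel n w h" for h
      using that by (cases rule: groth_rel.cases) (use False in auto)
    with less(2,3) show ?thesis by blast
  next
    case True
    then have "w \<noteq> longest n" by (auto simp: longest_def)
    obtain j f' where j: "j \<in> {1..<n}" "w j < w (Suc j)"
      and f: "f = idivdiff j f'" "groth_rel n (w \<circ> transpose j (Suc j)) f'"
      using less(2) \<open>w \<noteq> longest n\<close> by (rule groth_rel_ascentE)
    obtain k g' where k: "k \<in> {1..<n}" "w k < w (Suc k)"
      and g: "g = idivdiff k g'" "groth_rel n (w \<circ> transpose k (Suc k)) g'"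
      using less(3) \<open>w \<noteq> longest n\<close> by (rule groth_rel_ascentE)
    have IHj: "f' = p" if "groth_rel n (w \<circ> transpose j (Suc j)) p" for p
      using less(1)[OF height_swap[OF j] f(2) that] .
    have IHk: "g' = p" if "groth_rel n (w \<circ> transpose k (Suc k)) p" for p
      using less(1)[OF height_swap[OF k] g(2) that] .
    show ?thesis
    proof (cases j k rule: linorder_cases)
      case equal
      then show ?thesis using IHj f g by simp
    next
      case 2: less
      obtain p q where "groth_rel n (w \<circ> transpose j (Suc j)) p"
        "groth_rel n (w \<circ> transpose k (Suc k)) q" "idivdiff j p = idivdiff k q"
        using w j k 2 by (rule groth_rel_confluent)
      with IHj IHk show ?thesis by (simp add: f(1) g(1))
    next
      case greater
      obtain p q where "groth_rel n (w \<circ> transpose k (Suc k)) p"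
        "groth_rel n (w \<circ> transpose j (Suc j)) q" "idivdiff k p = idivdiff j q"
        using w k j greater by (rule groth_rel_confluent)
      with IHj IHk show ?thesis by (simp add: f(1) g(1))
    qed
  qed
qed

theorem groth_rel_ex1: "w permutes {1..n} \<Longrightarrow> \<exists>!f. groth_rel n w f"
  using groth_rel_exists groth_rel_unique by blast

lemma groth_rel_grothendieck: "w permutes {1..n} \<Longrightarrow> groth_rel n w (grothendieck n w)"
  unfolding grothendieck_def by (rule theI') (rule groth_rel_ex1)

lemma grothendieck_eqI: "groth_rel n w f \<Longrightarrow> grothendieck n w = f"
  using groth_rel_unique groth_rel_grothendieck groth_rel_permutes by blast

theorem grothendieck_longest: "grothendieck n (longest n) = (\<Prod>k=1..n. X k ^ (n - k))"
  by (intro grothendieck_eqI groth_rel.longest)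

theorem grothendieck_ascent:
  assumes "w permutes {1..n}" "j \<in> {1..<n}" "w j < w (Suc j)"
  shows "grothendieck n w = idivdiff j (grothendieck n (w \<circ> transpose j (Suc j)))"
  using assms by (intro grothendieck_eqI groth_rel.ascent groth_rel_grothendieck permutes_swap)

end

theory Submission
  imports Defs
begin

text \<open>
  Following Fomin and Kirillov, the Grothendieck polynomials are the coefficients of a product
  \<open>A\<^sub>1(x\<^sub>1) \<cdots> A\<^sub>n\<^sub>-\<^sub>1(x\<^sub>n\<^sub>-\<^sub>1)\<close> in the 0-Hecke algebra, where
  \<open>A\<^sub>i(x) = h\<^sub>n\<^sub>-\<^sub>1(x) \<cdots> h\<^sub>i(x)\<close> and \<open>h\<^sub>j(x) = 1 + x u\<^sub>j\<close> with \<open>u\<^sub>j\<^sup>2 = -u\<^sub>j\<close>; the Yang-Baxter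
  relation makes \<open>A\<^sub>i(x)\<close> and \<open>A\<^sub>i(y)\<close> commute.  All contributions to the coefficient of a
  monomial in this product have the same sign, so nothing cancels.

  The vectors \<open>L\<^sub>w(s)\<close> agree with \<open>invcode\<close> before some position and with \<open>rajcode\<close> after it,
  so the factors can be treated one at a time.  The factor \<open>A\<^sub>i\<close> must first use
  \<open>h\<^sub>i, \<dots>, h\<^sub>a\<^sub>-\<^sub>1\<close> with \<open>a = w(i)\<close>, which gives \<open>invcode(w)\<^sub>i\<close>.  Let \<open>\<rho>\<close> be \<open>rajcode_bar w\<close>.
  Among the factors \<open>h\<^sub>K\<close> with \<open>K > a\<close>, processed from the top, those for which \<open>K + 1\<close> stands
  before \<open>K\<close> may contribute a further \<open>x\<^sub>i\<close>, with the values \<open>K\<close> and \<open>K + 1\<close> either exchanged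
  or left alone; they are exchanged exactly when this does not change \<open>\<rho>\<close>.  Then \<open>\<rho>\<close> at the
  position of the current value never decreases, and it grows at each \<open>h\<^sub>K\<close> that cannot
  contribute, so at most \<open>\<rho>\<^sub>i - 1\<close> factors fail to contribute and the exponent \<open>rajcode(w)\<^sub>i\<close> is
  reached; stopping early gives the smaller exponents.
\<close>

section \<open>The 0-Hecke algebra\<close>

text \<open>
  A family \<open>F\<close> encodes the element \<open>\<Sum>\<^sub>w F (inv w) u\<^sub>w\<close> of the 0-Hecke algebra.  The index is the
  inverse of \<open>w\<close>, so that left multiplication by \<open>u\<^sub>j\<close> acts on positions.  With
  \<open>e\<^sub>j F p = F (sort_pos j p)\<close>, the idempotent \<open>e\<^sub>j\<close> is \<open>1 + u\<^sub>j\<close>, and \<open>hecke j x\<close> is \<open>1 + x u\<^sub>j\<close>.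
\<close>

type_synonym family = "(nat \<Rightarrow> nat) \<Rightarrow> zpoly"

definition sort_pos :: "nat \<Rightarrow> (nat \<Rightarrow> nat) \<Rightarrow> nat \<Rightarrow> nat" where
  "sort_pos j p = p(j := min (p j) (p (Suc j)), Suc j := max (p j) (p (Suc j)))"

lemma sort_pos_alt: "sort_pos j p = (if p (Suc j) < p j then p \<circ> transpose j (Suc j) else p)"
  by (auto simp: sort_pos_def fun_eq_iff transpose_def)

lemma sort_pos_idem [simp]: "sort_pos j (sort_pos j p) = sort_pos j p"
  by (auto simp: sort_pos_def fun_eq_iff)

lemma sort_pos_braid:
  "sort_pos (Suc j) (sort_pos j (sort_pos (Suc j) p)) =
      sort_pos j (sort_pos (Suc j) (sort_pos j p))"
  by (auto simp: sort_pos_def fun_eq_iff min_def max_def)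

lemma sort_pos_commute: "Suc j < k \<Longrightarrow> sort_pos j (sort_pos k p) = sort_pos k (sort_pos j p)"
  by (auto simp: sort_pos_def fun_eq_iff)

lemma bij_sort_pos: "bij p \<Longrightarrow> bij (sort_pos j p)"
  by (auto simp: sort_pos_alt intro: bij_comp)

definition hecke :: "nat \<Rightarrow> zpoly \<Rightarrow> family \<Rightarrow> family" where
  "hecke j x F p = (1 - x) * F p + x * F (sort_pos j p)"

text \<open>\<open>fold\<close> applies \<open>hecke i\<close> first, so this is left multiplication
  by \<open>h_{k-1}(x) ... h_i(x)\<close>, and \<open>row i n x\<close> is
  \<open>A_i(x)\<close>.\<close>

definition row :: "nat \<Rightarrow> nat \<Rightarrow> zpoly \<Rightarrow> family \<Rightarrow> family" where
  "row i k x = fold (\<lambda>j. hecke j x) [i..<k]"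

lemma row_trivial [simp]: "k \<le> i \<Longrightarrow> row i k x F = F"
  by (simp add: row_def)

lemma row_first: "i < k \<Longrightarrow> row i k x F = row (Suc i) k x (hecke i x F)"
  by (simp add: row_def upt_conv_Cons)

lemma row_last: "i \<le> k \<Longrightarrow> row i (Suc k) x F = hecke k x (row i k x F)"
  by (simp add: row_def)

section \<open>Linearity over the polynomial ring, inverses and commutation\<close>

definition linear_op :: "(family \<Rightarrow> family) \<Rightarrow> bool" where
  "linear_op \<Phi> \<longleftrightarrow>
     (\<forall>a b F H. \<Phi> (\<lambda>p. a * F p + b * H p) = (\<lambda>p. a * \<Phi> F p + b * \<Phi> H p))"

lemma linear_op_add:
  "linear_op \<Phi> \<Longrightarrow> \<Phi> (\<lambda>p. a * F p + b * H p) p = a * \<Phi> F p + b * \<Phi> H p"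
  by (simp add: linear_op_def)

lemma linear_op_scale: "linear_op \<Phi> \<Longrightarrow> \<Phi> (\<lambda>p. a * F p) p = a * \<Phi> F p"
  using linear_op_add[of \<Phi> a F 0 F p] by simp

lemma linear_op_compose: "linear_op \<Phi> \<Longrightarrow> linear_op \<Psi> \<Longrightarrow> linear_op (\<lambda>F. \<Phi> (\<Psi> F))"
  by (simp add: linear_op_def)

lemma linear_op_hecke: "linear_op (hecke j x)"
  by (simp add: linear_op_def hecke_def fun_eq_iff algebra_simps)

lemma linear_op_row: "linear_op (row i k x)"
proof -
  have "linear_op (fold (\<lambda>j. hecke j x) js)" for js
  proof (induction js)
    case Nil
    then show ?case by (simp add: linear_op_def)
  next
    case (Cons j js)
    then show ?case using linear_op_compose[OF Cons linear_op_hecke[of j x]] by (simp add: comp_def)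
  qed
  then show ?thesis by (simp add: row_def)
qed

text \<open>Since \<open>e_j\<close> is idempotent, \<open>1 - x e_j\<close> inverts
  \<open>h_j(x)\<close> up to the scalar \<open>1 - x\<close>. This replaces division in what
  follows.\<close>

lemma hecke_inverse: "hecke j x (\<lambda>p. F p - x * F (sort_pos j p)) = (\<lambda>p. (1 - x) * F p)"
  by (simp add: hecke_def fun_eq_iff algebra_simps)

lemma hecke_sort_pos: "hecke j x (\<lambda>p. F (sort_pos j p)) = (\<lambda>p. F (sort_pos j p))"
  by (simp add: hecke_def fun_eq_iff algebra_simps)

lemma hecke_commute: "hecke j x (hecke j y F) = hecke j y (hecke j x F)"
  by (simp add: hecke_def fun_eq_iff algebra_simps)

lemma hecke_commute_far: "Suc j < k \<Longrightarrow> hecke j x (hecke k y F) = hecke k y (hecke j x F)"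
  by (simp add: hecke_def fun_eq_iff algebra_simps sort_pos_commute[of j k])

lemma hecke_row_commute:
  assumes "Suc j < i"
  shows "hecke j x (row i k y F) = row i k y (hecke j x F)"
proof (induction k)
  case (Suc k)
  then show ?case
    using assms by (cases "i \<le> k") (simp_all add: row_last hecke_commute_far[of j k x y])
qed simp

text \<open>The letters are the values of a family at \<open>p\<close> and its sorted forms:
  \<open>a\<close> at \<open>p\<close>, \<open>b\<close> and \<open>c\<close> after sorting at
  \<open>j\<close> and at \<open>Suc j\<close>, \<open>d\<close> after \<open>j\<close> then
  \<open>Suc j\<close>, \<open>e\<close> after \<open>Suc j\<close> then \<open>j\<close>,
  \<open>g\<close> after all three sorts.\<close>

lemma yang_baxter_ring_identity:
  fixes a b c d e g x y :: "'a::comm_ring_1"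
  shows "(1 - x) *
    ((1 - x) * ((1 - y) * ((1 - y) * a + y * b) + y * ((1 - y) * c + y * e)) +
     x * ((1 - y) * ((1 - y) * b + y * b) + y * ((1 - y) * d + y * g)) -
     y * ((1 - x) * ((1 - y) * ((1 - y) * c + y * e) + y * ((1 - y) * c + y * e)) +
       x * ((1 - y) * ((1 - y) * e + y * e) + y * ((1 - y) * g + y * g)))) =
   (1 - y) *
    ((1 - y) * ((1 - x) * ((1 - x) * a + x * b) + x * ((1 - x) * c + x * e)) +
     y * ((1 - x) * ((1 - x) * b + x * b) + x * ((1 - x) * d + x * g)) -
     x * ((1 - y) * ((1 - x) * ((1 - x) * c + x * e) + x * ((1 - x) * c + x * e)) +
       y * ((1 - x) * ((1 - x) * e + x * e) + x * ((1 - x) * g + x * g))))"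
  by (simp add: algebra_simps)

text \<open>The symmetry of \<open>h_{j+1}(y)^{-1} h_j(x) h_{j+1}(y) h_j(y)\<close> in
  \<open>x\<close> and \<open>y\<close>, multiplied by \<open>(1 - x) * (1 - y)\<close> to clear the
  denominators.\<close>

lemma hecke_yang_baxter:
  fixes F :: family and j :: nat
  defines "K \<equiv> \<lambda>x y. hecke j x (hecke (Suc j) y (hecke j y F))"
  shows "(1 - x) * (K x y p - y * K x y (sort_pos (Suc j) p)) =
    (1 - y) * (K y x p - x * K y x (sort_pos (Suc j) p))"
  unfolding K_def hecke_def sort_pos_idem sort_pos_braid by (rule yang_baxter_ring_identity)

lemma row_absorb:
  assumes "i < k"
  shows "row i k y (\<lambda>p. F p - y * F (sort_pos i p)) p = (1 - y) * row (Suc i) k y F p"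
  using assms by (simp add: row_first hecke_inverse linear_op_scale[OF linear_op_row])

text \<open>Moving \<open>h_j(x)\<close> past the distant factors turns \<open>A_j(x) A_j(y)\<close>
  into \<open>A_{j+1}(x) A_{j+2}(y) K(x,y)\<close>. Completing \<open>A_{j+2}(y)\<close> to
  \<open>A_{j+1}(y)\<close> costs a factor \<open>1 - y\<close>; then the induction hypothesis and
  the Yang-Baxter relation exchange \<open>x\<close> and \<open>y\<close>. The nonzero scalars
  \<open>1 - x\<close> and \<open>1 - y\<close> cancel at the end.\<close>

lemma row_commute:
  assumes "x \<noteq> 1" "y \<noteq> 1"
  shows "row j n x (row j n y F) = row j n y (row j n x F)"
proof (induction "n - j" arbitrary: j F rule: less_induct)
  case less
  consider "n \<le> j" | "n = Suc j" | "Suc j < n" by linarith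
  then show ?case
  proof cases
    case 2
    then show ?thesis by (simp add: row_first hecke_commute)
  next
    case 3
    define K where "K = (\<lambda>x y. hecke j x (hecke (Suc j) y (hecke j y F)))"
    define T where "T = (\<lambda>x y K. row (Suc j) n x (row (Suc j) n y K))"
    have lin: "linear_op (T x y)" for x y
      unfolding T_def by (rule linear_op_compose[OF linear_op_row linear_op_row])
    have prod: "row j n x (row j n y F) = row (Suc j) n x (row (Suc (Suc j)) n y (K x y))" for x y
      using 3 by (simp add: row_first K_def hecke_row_commute[of j "Suc (Suc j)"])
    have "(1 - x) * ((1 - y) * row j n x (row j n y F) p) =
        T x y (\<lambda>p. (1 - x) * (K x y p - y * K x y (sort_pos (Suc j) p))) p" for x y p
    proof -
      have "row (Suc j) n y (\<lambda>p. K x y p - y * K x y (sort_pos (Suc j) p)) =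
          (\<lambda>p. (1 - y) * row (Suc (Suc j)) n y (K x y) p)"
        using 3 row_absorb by blast
      then show ?thesis
        unfolding linear_op_scale[OF lin]
          by (simp add: T_def prod linear_op_scale[OF linear_op_row])
    qed
    from this[of x y] this[of y x]
    have "(1 - x) * ((1 - y) * row j n x (row j n y F) p) =
        (1 - x) * ((1 - y) * row j n y (row j n x F) p)" for p
      using less[of "Suc j"] 3 hecke_yang_baxter[of x j y F]
      by (simp add: T_def K_def mult.left_commute)
    then show ?thesis using assms by (auto simp: fun_eq_iff)
  qed simp
qed

section \<open>The product of all rows\<close>

definition unit_family :: family where
  "unit_family p = (if p = id then 1 else 0)"

definition rows :: "nat \<Rightarrow> nat list \<Rightarrow> family \<Rightarrow> family" where
  "rows n = foldr (\<lambda>i. row i n (X i))"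

lemma rows_simps [simp]:
  "rows n [] F = F" "rows n (i # js) F = row i n (X i) (rows n js F)"
  "rows n (ks @ js) F = rows n ks (rows n js F)"
  by (simp_all add: rows_def)

text \<open>The tail \<open>A_i(x_i) ... A_{n-1}(x_{n-1})\<close> of the product; the whole product
  is the case \<open>i = 1\<close>.\<close>

definition groth_family :: "nat \<Rightarrow> nat \<Rightarrow> family" where
  "groth_family n i = rows n [i..<n] unit_family"

lemma groth_family_step: "groth_family n i = row i n (X i) (groth_family n (Suc i))"
  by (cases "i < n") (simp_all add: groth_family_def upt_conv_Cons)

lemma groth_family_beyond: "n \<le> i \<Longrightarrow> groth_family n i = unit_family"
  by (simp add: groth_family_def)

lemma linear_op_rows: "linear_op (rows n js)"
proof (induction js)
  case Nil
  then show ?case by (simp add: linear_op_def)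
next
  case (Cons j js)
  then show ?case using linear_op_compose[OF linear_op_row Cons] by simp
qed

section \<open>Divided differences and right multiplication\<close>

lemma act_hecke: "act k (hecke j x F p) = hecke j (act k x) (\<lambda>p. act k (F p)) p"
  by (simp add: hecke_def)

lemma act_row: "(\<lambda>p. act k (row i m x F p)) = row i m (act k x) (\<lambda>p. act k (F p))"
proof (induction m)
  case (Suc m)
  then show ?case by (cases "i \<le> m") (simp_all add: row_last act_hecke)
qed simp

lemma act_rows:
  assumes "j \<notin> set js" "Suc j \<notin> set js"
  shows "(\<lambda>p. act j (rows n js F p)) = rows n js (\<lambda>p. act j (F p))"
  using assms by (induction js) (simp_all add: act_row)

lemma act_unit_family: "act j (unit_family p) = unit_family p"
  by (simp add: unit_family_def)

lemma X_neq_1: "X k \<noteq> 1"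
proof
  assume "X k = 1"
  then have "Poly_Mapping.lookup (X k) 0 = 1" by simp
  then have "Poly_Mapping.single k 1 = (0 :: nat \<Rightarrow>\<^sub>0 nat)"
    by (simp add: X_def lookup_single when_def split: if_splits)
  then show False by (metis lookup_single_eq lookup_zero zero_neq_one)
qed

lemma row_sort_pos: "i < k \<Longrightarrow> row (Suc i) k y (\<lambda>p. F (sort_pos i p)) =
    row i k y (\<lambda>p. F (sort_pos i p))"
  by (simp add: row_first hecke_sort_pos)

lemma rows_sort_pos:
  assumes "\<And>i. i \<in> set js \<Longrightarrow> Suc j < i"
  shows "rows n js (\<lambda>p. F (sort_pos j p)) = (\<lambda>p. rows n js F (sort_pos j p))"
proof -
  have hecke: "hecke k x (\<lambda>p. H (sort_pos j p)) = (\<lambda>p. hecke k x H (sort_pos j p))"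
    if "Suc j < k" for k x H
    using that by (simp add: hecke_def fun_eq_iff sort_pos_commute[of j k])
  have row: "row i m x (\<lambda>p. H (sort_pos j p)) = (\<lambda>p. row i m x H (sort_pos j p))"
    if "Suc j < i" for i m x H
  proof (induction m)
    case (Suc m)
    then show ?case using that by (cases "i \<le> m") (simp_all add: row_last hecke)
  qed simp
  show ?thesis using assms by (induction js) (simp_all add: row)
qed

text \<open>Write the product as \<open>P A_j(x) A_{j+1}(y) Q\<close> with \<open>x = X j\<close>,
  \<open>y = X (Suc j)\<close> and \<open>P\<close>, \<open>Q\<close> invariant under exchanging
  them. As \<open>(1 - y) A_{j+1}(y) = A_j(y) (1 - y e_j)\<close> and \<open>A_j(x) A_j(y)\<close>
  is symmetric, the numerator becomes \<open>(x - y) P A_j(x) A_j(y) e_j Q\<close>. Finally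
  \<open>h_j(y) e_j = e_j\<close> turns \<open>A_j(y)\<close> back into \<open>A_{j+1}(y)\<close>,
  and \<open>e_j\<close> commutes with \<open>Q\<close>.\<close>

lemma idivdiff_groth_family:
  assumes "1 \<le> j" "j < n"
  shows "idivdiff j (groth_family n 1 p) = rows n [1..<n] (\<lambda>p. unit_family (sort_pos j p)) p"
proof -
  let ?x = "X j" and ?y = "X (Suc j)" and ?P = "rows n [1..<j]"
  define Q where "Q = groth_family n (Suc (Suc j))"
  define B where "B = (\<lambda>F. row j n ?x (row j n ?y F))"
  define S where "S = (\<lambda>x y F. row j n x (row (Suc j) n y F))"
  have B: "B F = row j n ?y (row j n ?x F)" for F
    unfolding B_def by (intro row_commute X_neq_1)
  have linB: "linear_op B" unfolding B_def
    by (rule linear_op_compose[OF linear_op_row linear_op_row])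
  have upt: "[1..<n] = [1..<j] @ [j..<n]"
    using assms by (metis upt_add_eq_append le_add_diff_inverse less_imp_le)
  have G_eq: "groth_family n 1 = ?P (S ?x ?y Q)"
  proof -
    have "groth_family n 1 = ?P (groth_family n j)" unfolding groth_family_def upt by simp
    then show ?thesis
      by (simp add: S_def Q_def groth_family_step[of n j] groth_family_step[of n "Suc j"])
  qed
  have "(\<lambda>p. act j (Q p)) = Q"
    unfolding Q_def groth_family_def by (subst act_rows) (auto simp: act_unit_family)
  then have actG: "act j (groth_family n 1 p) = ?P (S ?y ?x Q) p" for p
    unfolding G_eq using act_rows[of j "[1..<j]" n "S ?x ?y Q"]
    by (simp add: S_def act_row fun_eq_iff)
  have e1: "(1 - ?y) * S ?x ?y Q p = B (\<lambda>p. Q p - ?y * Q (sort_pos j p)) p" for p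
  proof -
    have "row j n ?y (\<lambda>p. Q p - ?y * Q (sort_pos j p)) = (\<lambda>p. (1 - ?y) * row (Suc j) n ?y Q p)"
      using assms row_absorb by blast
    then show ?thesis by (simp add: S_def B_def linear_op_scale[OF linear_op_row])
  qed
  have e2: "(1 - ?x) * S ?y ?x Q p = B (\<lambda>p. Q p - ?x * Q (sort_pos j p)) p" for p
  proof -
    have "row j n ?x (\<lambda>p. Q p - ?x * Q (sort_pos j p)) = (\<lambda>p. (1 - ?x) * row (Suc j) n ?x Q p)"
      using assms row_absorb by blast
    then show ?thesis by (simp add: S_def B linear_op_scale[OF linear_op_row])
  qed
  have key: "(1 - ?y) * S ?x ?y Q p + - (1 - ?x) * S ?y ?x Q p =
      (?x - ?y) * S ?x ?y (\<lambda>p. Q (sort_pos j p)) p" for p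
  proof -
    have "(1 - ?y) * S ?x ?y Q p + - (1 - ?x) * S ?y ?x Q p =
        1 * B (\<lambda>p. Q p - ?y * Q (sort_pos j p)) p + (- 1) * B (\<lambda>p. Q p - ?x * Q (sort_pos j p)) p"
      by (simp only: e1[symmetric] e2[symmetric] mult_1_left mult_minus_left)
    also have "\<dots> = B (\<lambda>p. (?x - ?y) * Q (sort_pos j p)) p"
      unfolding linear_op_add[OF linB, symmetric] by (simp add: algebra_simps)
    also have "\<dots> = (?x - ?y) * S ?x ?y (\<lambda>p. Q (sort_pos j p)) p"
      unfolding linear_op_scale[OF linB] using assms by (simp add: S_def B_def row_sort_pos)
    finally show ?thesis .
  qed
  have "idivdiff j (groth_family n 1 p) * (?x - ?y) =
      (1 - ?y) * ?P (S ?x ?y Q) p + - (1 - ?x) * ?P (S ?y ?x Q) p"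
    unfolding idivdiff actG unfolding G_eq by (simp only: diff_conv_add_uminus mult_minus_left)
  also have "\<dots> = ?P (\<lambda>p. (?x - ?y) * S ?x ?y (\<lambda>p. Q (sort_pos j p)) p) p"
    unfolding linear_op_add[OF linear_op_rows, symmetric] key ..
  also have "\<dots> = ?P (S ?x ?y (\<lambda>p. Q (sort_pos j p))) p * (?x - ?y)"
    unfolding linear_op_scale[OF linear_op_rows] by simp
  finally have "idivdiff j (groth_family n 1 p) = ?P (S ?x ?y (\<lambda>p. Q (sort_pos j p))) p"
    using X_diff_nonzero[of j "Suc j"] by simp
  also have "(\<lambda>p. Q (sort_pos j p)) = rows n [Suc (Suc j)..<n] (\<lambda>p. unit_family (sort_pos j p))"
    unfolding Q_def groth_family_def by (subst rows_sort_pos) auto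
  also have "S ?x ?y \<dots> = rows n [j..<n] (\<lambda>p. unit_family (sort_pos j p))"
    using assms by (cases "Suc j < n") (simp_all add: S_def upt_conv_Cons)
  finally show ?thesis unfolding upt by simp
qed

text \<open>Composition with \<open>sort_val j\<close> is right multiplication by \<open>1 + u\<^sub>j\<close>.\<close>

definition sort_val :: "nat \<Rightarrow> (nat \<Rightarrow> nat) \<Rightarrow> nat \<Rightarrow> nat" where
  "sort_val j p = (if inv p (Suc j) < inv p j then transpose j (Suc j) \<circ> p else p)"

lemma bij_transpose_comp: "bij p \<Longrightarrow> bij (transpose a b \<circ> p)" "bij p \<Longrightarrow> bij (p \<circ> transpose a b)"
  by (auto intro: bij_comp)

lemma inv_transpose_comp:
  "bij p \<Longrightarrow> inv (transpose a b \<circ> p) = inv p \<circ> transpose a b"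
  "bij p \<Longrightarrow> inv (p \<circ> transpose a b) = transpose a b \<circ> inv p"
  by (simp_all add: o_inv_distrib)

lemma transpose_less_iff:
  assumes "\<not> {a, b} \<subseteq> {k, Suc k}" "a \<noteq> b"
  shows "transpose k (Suc k) a < transpose k (Suc k) b \<longleftrightarrow> a < b"
  using assms by (auto simp: transpose_def)

text \<open>Left and right multiplication commute. If \<open>p\<close> maps
  \<open>{k, Suc k}\<close> onto \<open>{j, Suc j}\<close>, the two exchanges coincide; otherwise
  neither exchange affects the comparison that decides the other.\<close>

lemma sort_val_sort_pos:
  assumes "bij p"
  shows "sort_val j (sort_pos k p) = sort_pos k (sort_val j p)"
proof -
  let ?s = "transpose j (Suc j)" and ?t = "transpose k (Suc k)"
  have inj: "p x = p y \<longleftrightarrow> x = y" for x y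
    using assms by (simp add: bij_def inj_eq)
  have invp: "inv p y = x \<longleftrightarrow> p x = y" for x y
    using assms by (metis bij_inv_eq_iff)
  show ?thesis
  proof (cases "{p k, p (Suc k)} = {j, Suc j}")
    case True
    then consider "p k = j" "p (Suc k) = Suc j" | "p k = Suc j" "p (Suc k) = j"
      by (auto simp: doubleton_eq_iff)
    then have comm: "p \<circ> ?t = ?s \<circ> p"
      by cases (auto simp: fun_eq_iff transpose_def inj, (metis inj)+)
    from True consider "p k = j" "p (Suc k) = Suc j" | "p k = Suc j" "p (Suc k) = j"
      by (auto simp: doubleton_eq_iff)
    then show ?thesis
    proof cases
      case 1
      then have "inv p j = k" "inv p (Suc j) = Suc k" by (simp_all add: invp)
      with 1 show ?thesis by (simp add: sort_val_def sort_pos_alt)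
    next
      case 2
      then have "inv p j = Suc k" "inv p (Suc j) = k" by (simp_all add: invp)
      with 2 show ?thesis
        using assms by (simp add: sort_val_def sort_pos_alt inv_transpose_comp comm)
    qed
  next
    case False
    have R: "(?s \<circ> p) (Suc k) < (?s \<circ> p) k \<longleftrightarrow> p (Suc k) < p k"
    proof -
      have "p (Suc k) \<noteq> p k" by (simp add: inj)
      then show ?thesis unfolding comp_def using False by (intro transpose_less_iff) auto
    qed
    have "inv p j \<noteq> inv p (Suc j)"
      using assms by (metis bij_inv_eq_iff n_not_Suc_n)
    moreover have "\<not> {inv p (Suc j), inv p j} \<subseteq> {k, Suc k}"
      using False calculation by (auto simp: invp)
    ultimately have L: "(?t \<circ> inv p) (Suc j) < (?t \<circ> inv p) j \<longleftrightarrow> inv p (Suc j) < inv p j"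
      unfolding comp_def by (intro transpose_less_iff) auto
    show ?thesis
      using R L assms by (auto simp: sort_val_def sort_pos_alt inv_transpose_comp comp_assoc)
  qed
qed

lemma rows_sort_val:
  assumes "\<And>p. bij p \<Longrightarrow> F' p = F (sort_val j p)" and "bij p"
  shows "rows n js F' p = rows n js F (sort_val j p)"
proof -
  have hecke: "hecke k x H' p = hecke k x H (sort_val j p)"
    if "\<And>p. bij p \<Longrightarrow> H' p = H (sort_val j p)" "bij p" for k x H H' p
    using that by (simp add: hecke_def sort_val_sort_pos[symmetric] bij_sort_pos)
  have row: "row i m x H' p = row i m x H (sort_val j p)"
    if "\<And>p. bij p \<Longrightarrow> H' p = H (sort_val j p)" "bij p" for i m x H H' p
    using that(2)
  proof (induction m arbitrary: p)
    case (Suc m)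
    then show ?case
      using that(1) hecke[of "row i m x H'" "row i m x H"] by (cases "i \<le> m") (simp_all add: row_last)
  qed (simp add: that)
  show ?thesis
    using assms(2) by (induction js arbitrary: p) (simp_all add: assms(1) row)
qed

text \<open>Left and right multiplication by \<open>1 + u_j\<close> agree on the unit
  element.\<close>

lemma unit_family_sort: "unit_family (sort_pos j p) = unit_family (sort_val j p)"
proof -
  let ?s = "transpose j (Suc j)"
  have "p = ?s" if "p \<circ> ?s = id"
  proof
    show "p x = ?s x" for x using fun_cong[OF that, of "?s x"] by simp
  qed
  then have "sort_pos j p = id \<longleftrightarrow> p = id \<or> p = ?s" by (auto simp: sort_pos_alt)
  moreover have "p = ?s" if "?s \<circ> p = id"
  proof
    show "p x = ?s x" for x using arg_cong[OF fun_cong[OF that, of x], of ?s] by simp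
  qed
  then have "sort_val j p = id \<longleftrightarrow> p = id \<or> p = ?s" by (auto simp: sort_val_def)
  ultimately show ?thesis by (simp add: unit_family_def)
qed

text \<open>\<open>sort_val j\<close> removes the descent created at \<open>j\<close>, so the
  coefficients of the product satisfy the recursion of the Grothendieck polynomials.\<close>

lemma idivdiff_groth_family_ascent:
  assumes w: "w permutes {1..n}" and j: "j \<in> {1..<n}" "w j < w (Suc j)"
  shows "idivdiff j (groth_family n 1 (inv (w \<circ> transpose j (Suc j)))) = groth_family n 1 (inv w)"
proof -
  let ?s = "transpose j (Suc j)"
  have bw: "bij w" using w by (rule permutes_bij)
  then have b: "bij (inv (w \<circ> ?s))" by (simp add: bij_transpose_comp bij_imp_bij_inv)
  have "sort_val j (inv (w \<circ> ?s)) = inv w"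
  proof -
    have "inv (inv (w \<circ> ?s)) = w \<circ> ?s" using bw by (simp add: inv_inv_eq bij_transpose_comp)
    moreover have "?s \<circ> inv (w \<circ> ?s) = inv w"
      using bw by (simp add: inv_transpose_comp fun_eq_iff)
    ultimately show ?thesis using j(2) by (simp add: sort_val_def)
  qed
  moreover have "idivdiff j (groth_family n 1 (inv (w \<circ> ?s))) =
      rows n [1..<n] (\<lambda>p. unit_family (sort_pos j p)) (inv (w \<circ> ?s))"
    using j by (intro idivdiff_groth_family) auto
  moreover have "\<dots> = groth_family n 1 (sort_val j (inv (w \<circ> ?s)))"
    unfolding groth_family_def by (rule rows_sort_val) (rule unit_family_sort, rule b)
  ultimately show ?thesis by simp
qed

section \<open>Splitting off the first row\<close>

lemma row_zero_outside:
  assumes "\<And>p. p k \<noteq> k \<Longrightarrow> F p = 0" "k < i" "p k \<noteq> k"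
  shows "row i m x F p = 0"
  using assms(3)
proof (induction m arbitrary: p)
  case (Suc m)
  show ?case
  proof (cases "i \<le> m")
    case True
    have "sort_pos m p k = p k" using True assms(2) by (simp add: sort_pos_def)
    then show ?thesis using True Suc by (simp add: row_last hecke_def)
  qed (use Suc assms(1) in simp)
qed (simp add: assms(1))

text \<open>Only \<open>u_i, u_{i+1}, ...\<close> occur in the tail product, and none of them moves
  \<open>k\<close>.\<close>

lemma groth_family_zero:
  assumes "k < i" "p k \<noteq> k"
  shows "groth_family n i p = 0"
proof -
  have "rows n js unit_family p = 0" if "\<forall>i\<in>set js. k < i" for js
    using that assms(2)
  proof (induction js arbitrary: p)
    case (Cons i js)
    then show ?case using row_zero_outside[of k "rows n js unit_family" i] by simp
  qed (auto simp: unit_family_def)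
  then show ?thesis using assms(1) by (simp add: groth_family_def)
qed

text \<open>The factors \<open>h_i, ..., h_{m-1}\<close> sort within the positions
  \<open>i..m\<close>, so they cannot bring the value \<open>i\<close> to position \<open>i\<close>
  from outside, and \<open>F\<close> vanishes unless it is there.\<close>

lemma row_zero:
  assumes "\<And>p. p i \<noteq> i \<Longrightarrow> F p = 0" "i \<le> m" "\<forall>k\<in>{i..m}. p k \<noteq> i"
  shows "row i m x F p = 0"
  using assms(2,3)
proof (induction m arbitrary: p rule: dec_induct)
  case (step m)
  have "\<forall>k\<in>{i..m}. sort_pos m p k \<noteq> i"
    using step.prems step.hyps by (auto simp: sort_pos_def min_def)
  then show ?case using step by (simp add: row_last hecke_def)
qed (simp add: assms(1))

text \<open>
  The permutation of \<open>{i<..n}\<close> with the same relative order as \<open>w\<close> on the positions after \<open>i\<close>.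
\<close>

definition drop_first :: "nat \<Rightarrow> (nat \<Rightarrow> nat) \<Rightarrow> nat \<Rightarrow> nat" where
  "drop_first i w k = (if k \<le> i then k else if w k < w i then Suc (w k) else w k)"

lemma permutes_eq_iff: "w permutes S \<Longrightarrow> w x = w y \<longleftrightarrow> x = y"
  by (metis permutes_inj injD)

lemma permutes_interval:
  assumes "w permutes {i..n}"
  shows "i \<le> k \<Longrightarrow> k \<le> n \<Longrightarrow> i \<le> w k \<and> w k \<le> n"
  using permutes_in_image[OF assms, of k] by simp

lemma drop_first_less_iff:
  assumes "w permutes {i..n}" "i < k" "i < k'"
  shows "drop_first i w k < drop_first i w k' \<longleftrightarrow> w k < w k'"
  using assms permutes_eq_iff[OF assms(1), of k i] permutes_eq_iff[OF assms(1), of k' i]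
  by (auto simp: drop_first_def)

lemma drop_first_permutes:
  assumes w: "w permutes {i..n}" and "i \<le> n"
  shows "drop_first i w permutes {Suc i..n}"
proof (rule bij_imp_permutes)
  have "inj_on (drop_first i w) {Suc i..n}"
  proof (rule inj_onI)
    fix k k' assume "k \<in> {Suc i..n}" "k' \<in> {Suc i..n}" "drop_first i w k = drop_first i w k'"
    then have "w k = w k'"
      using drop_first_less_iff[OF w, of k k'] drop_first_less_iff[OF w, of k' k] by auto
    then show "k = k'" by (simp add: permutes_eq_iff[OF w])
  qed
  moreover have "drop_first i w ` {Suc i..n} \<subseteq> {Suc i..n}"
  proof safe
    fix k assume k: "k \<in> {Suc i..n}"
    then have "w k \<noteq> w i" by (simp add: permutes_eq_iff[OF w])
    then show "drop_first i w k \<in> {Suc i..n}"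
      using k permutes_interval[OF w, of k] permutes_interval[OF w, of i] assms(2)
      by (auto simp: drop_first_def)
  qed
  ultimately show "bij_betw (drop_first i w) {Suc i..n} {Suc i..n}"
    by (simp add: bij_betw_def endo_inj_surj)
next
  fix k assume "k \<notin> {Suc i..n}"
  then show "drop_first i w k = k"
    using permutes_not_in[OF w, of k] permutes_interval[OF w, of i] assms(2)
    by (auto simp: drop_first_def)
qed

text \<open>A single term survives: each of \<open>h_{a-1}, ..., h_i\<close> with
  \<open>a = w i\<close> must exchange its two values, so that the value at position
  \<open>i\<close> descends step by step to \<open>i\<close>.\<close>

lemma row_first_value:
  assumes "w permutes {i..n}" "i \<le> n" and F: "\<And>p. p i \<noteq> i \<Longrightarrow> F p = 0"
  shows "row i (w i) x F (inv w) = x ^ (w i - i) * F (inv (drop_first i w))"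
proof -
  have "row i a x F (inv w) = x ^ (a - i) * F (inv (drop_first i w))"
    if "i \<le> a" "w permutes {i..n}" "w i = a" for a w
    using that
  proof (induction a arbitrary: w rule: dec_induct)
    case base
    note w = base(1)
    have "drop_first i w = w"
    proof
      fix k
      show "drop_first i w k = w k"
        using permutes_not_in[OF w, of k] permutes_interval[OF w, of k] base(2) assms(2)
        by (cases "k < i"; cases "k \<le> n") (auto simp: drop_first_def)
    qed
    then show ?case using base by simp
  next
    case (step a)
    note w = step.prems(1)
    let ?s = "transpose a (Suc a)"
    let ?w = "?s \<circ> w"
    have bw: "bij w" using w by (rule permutes_bij)
    have a: "i \<le> a" "w i = Suc a" "Suc a \<le> n"
      using step.hyps step.prems permutes_interval[OF w, of i] assms(2) by auto
    have w': "?w permutes {i..n}"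
      using a by (intro permutes_compose[OF w] permutes_swap_id) auto
    have inv_s: "inv w (Suc a) = i" using a(2) bw by (metis bij_inv_eq_iff)
    have "inv w a \<in> {i..n}"
      using permutes_in_image[OF permutes_inv[OF w], of a] a by simp
    moreover have "inv w a \<noteq> i" using a(2) bw by (metis bij_inv_eq_iff n_not_Suc_n)
    ultimately have desc: "inv w (Suc a) < inv w a" unfolding inv_s by simp
    then have inv_w: "sort_pos a (inv w) = inv ?w" by (simp add: sort_pos_alt inv_transpose_comp bw)
    \<comment> \<open>Without the exchange \<open>w i\<close> stays at \<open>Suc a\<close>, out of
      reach of the remaining factors.\<close>
    have zero: "row i a x F (inv w) = 0"
    proof (rule row_zero[OF F \<open>i \<le> a\<close>])
      show "\<forall>k\<in>{i..a}. inv w k \<noteq> i" using a(2) bw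
        by (metis atLeastAtMost_iff bij_inv_eq_iff Suc_n_not_le_n)
    qed
    have "drop_first i ?w = drop_first i w"
    proof
      fix k
      have "w k \<noteq> w i" if "i < k" using that by (simp add: permutes_eq_iff[OF w])
      then show "drop_first i ?w k = drop_first i w k"
        using a(2) by (auto simp: drop_first_def transpose_def)
    qed
    moreover have "?w i = a" using a by simp
    note step.IH[OF w' this]
    ultimately have "row i a x F (inv ?w) = x ^ (a - i) * F (inv (drop_first i w))"
      by (simp only:)
    then show ?case
      using a by (simp add: row_last hecke_def zero inv_w Suc_diff_le)
  qed
  moreover have "i \<le> w i" using permutes_interval[OF assms(1), of i] assms(2) by simp
  ultimately show ?thesis using assms(1) by blast
qed

text \<open>The reversal \<open>lon i\<close> of \<open>{i..n}\<close> sends \<open>i\<close> to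
  \<open>n\<close>, so every factor of row \<open>i\<close> contributes an \<open>X i\<close>, and
  removing position \<open>i\<close> leaves \<open>lon (Suc i)\<close>.\<close>

lemma groth_family_longest: "groth_family n 1 (inv (longest n)) = (\<Prod>k=1..n. X k ^ (n - k))"
proof -
  define lon where "lon = (\<lambda>i k. if k \<in> {i..n} then n + i - k else k)"
  have "lon i permutes {i..n} \<and> groth_family n i (inv (lon i)) = (\<Prod>k=i..n. X k ^ (n - k))"
    if "1 \<le> i" "i \<le> Suc n" for i
    using that(2,1)
  proof (induction i rule: inc_induct)
    case base
    have lon: "lon (Suc n) = id" by (auto simp: lon_def fun_eq_iff)
    show ?case unfolding lon inv_id
      by (simp add: permutes_id groth_family_beyond unit_family_def fun_eq_iff)
  next
    case (step i)
    have perm: "lon i permutes {i..n}"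
    proof (rule bij_imp_permutes)
      show "bij_betw (lon i) {i..n} {i..n}"
        by (rule bij_betw_byWitness[where f' = "lon i"]) (auto simp: lon_def)
    qed (auto simp: lon_def)
    have tl: "drop_first i (lon i) = lon (Suc i)"
      using step by (auto simp: drop_first_def lon_def fun_eq_iff)
    have "lon i i = n" using step by (simp add: lon_def)
    then have "groth_family n i (inv (lon i)) =
        X i ^ (n - i) * groth_family n (Suc i) (inv (lon (Suc i)))"
      using row_first_value[OF perm, of "groth_family n (Suc i)" "X i"] groth_family_zero[of i "Suc i"]
        step tl
      by (simp add: groth_family_step[of n i])
    then show ?case
      using step perm by (simp add: prod.atLeast_Suc_atMost)
  qed
  from this[of 1] have "groth_family n 1 (inv (lon 1)) = (\<Prod>k=1..n. X k ^ (n - k))" by simp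
  moreover have "lon 1 = longest n" by (auto simp: lon_def longest_def fun_eq_iff)
  ultimately show ?thesis by simp
qed

theorem grothendieck_eq_groth_family:
  assumes "w permutes {1..n}"
  shows "grothendieck n w = groth_family n 1 (inv w)"
proof -
  have "f = groth_family n 1 (inv w)" if "groth_rel n w f" for f w
    using that
  proof (induction rule: groth_rel.induct)
    case longest
    then show ?case by (simp only: groth_family_longest)
  next
    case (ascent w j f)
    then show ?case by (simp only: idivdiff_groth_family_ascent)
  qed
  then show ?thesis using groth_rel_grothendieck[OF assms] by blast
qed

section \<open>Signs\<close>

definition tdeg :: "(nat \<Rightarrow>\<^sub>0 nat) \<Rightarrow> nat" where
  "tdeg m = (\<Sum>k\<in>Poly_Mapping.keys m. Poly_Mapping.lookup m k)"

lemma tdeg_add: "tdeg (m + m') = tdeg m + tdeg m'"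
proof -
  have *: "tdeg r = sum (Poly_Mapping.lookup r) (Poly_Mapping.keys m \<union> Poly_Mapping.keys m')"
    if "Poly_Mapping.keys r \<subseteq> Poly_Mapping.keys m \<union> Poly_Mapping.keys m'" for r
    unfolding tdeg_def using that by (intro sum.mono_neutral_left) (auto simp: in_keys_iff)
  show ?thesis
    using *[of m] *[of m'] *[of "m + m'"] Poly_Mapping.keys_add[of m m']
    by (simp add: lookup_add sum.distrib)
qed

lemma tdeg_single: "tdeg (Poly_Mapping.single k c) = c"
  by (simp add: tdeg_def)

lemma lookup_X_mult_add: "Poly_Mapping.lookup (X i * f) (m + Poly_Mapping.single i 1) =
    Poly_Mapping.lookup f m"
proof (induction f rule: poly_mapping_induct_add)
  case (single m' c)
  have "Poly_Mapping.single i 1 + m' = m + Poly_Mapping.single i 1 \<longleftrightarrow> m' = m"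
    by (simp add: add.commute[of _ m'])
  then show ?case by (simp add: X_def mult_single lookup_single when_def)
qed (simp_all add: distrib_left lookup_add)

lemma lookup_X_mult_zero:
  assumes "Poly_Mapping.lookup m i = 0"
  shows "Poly_Mapping.lookup (X i * f) m = 0"
proof (induction f rule: poly_mapping_induct_add)
  case (single m' c)
  have "Poly_Mapping.single i 1 + m' \<noteq> m"
    using assms by (auto simp: lookup_add)
  then show ?case by (simp add: X_def mult_single lookup_single when_def)
qed (simp_all add: distrib_left lookup_add)

text \<open>Each new factor \<open>x\<close> in \<open>(1 - x) F(p) + x F(sort_pos j p)\<close>
  comes either with a coefficient \<open>-1\<close> or with an exchange that changes
  \<open>sign p\<close>. After this normalisation all contributions have the same sign.\<close>

definition signed_coeff :: "family \<Rightarrow> (nat \<Rightarrow> nat) \<Rightarrow> (nat \<Rightarrow>\<^sub>0 nat) \<Rightarrow> int" where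
  "signed_coeff F p m = sign p * (-1) ^ tdeg m * Poly_Mapping.lookup (F p) m"

lemma signed_coeff_neq_0: "signed_coeff F p m \<noteq> 0 \<longleftrightarrow> Poly_Mapping.lookup (F p) m \<noteq> 0"
  by (simp add: signed_coeff_def sign_def)

definition sign_coherent :: "family \<Rightarrow> bool" where
  "sign_coherent F \<longleftrightarrow> (\<forall>p m. permutation p \<longrightarrow> 0 \<le> signed_coeff F p m)"

lemma sign_coherentD: "sign_coherent F \<Longrightarrow> permutation p \<Longrightarrow> 0 \<le> signed_coeff F p m"
  by (simp add: sign_coherent_def)

lemma permutation_sort_pos: "permutation p \<Longrightarrow> permutation (sort_pos j p)"
  by (simp add: sort_pos_alt permutation_compose permutation_swap_id)

lemma hecke_no_descent:
  assumes "\<not> p (Suc j) < p j"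
  shows "hecke j x F p = F p"
  using assms by (simp add: hecke_def sort_pos_alt algebra_simps)

lemma signed_coeff_hecke_zero:
  assumes "Poly_Mapping.lookup m i = 0"
  shows "signed_coeff (hecke j (X i) F) p m = signed_coeff F p m"
  using assms by (simp add: signed_coeff_def hecke_def left_diff_distrib lookup_add lookup_minus
      lookup_X_mult_zero)

lemma signed_coeff_hecke_add:
  assumes "permutation p" "p (Suc j) < p j"
  shows "signed_coeff (hecke j (X i) F) p (m + Poly_Mapping.single i 1) =
    signed_coeff F p (m + Poly_Mapping.single i 1) + signed_coeff F p m +
    signed_coeff F (sort_pos j p) m"
proof -
  have "sign (sort_pos j p) = - sign p"
    using assms by (simp add: sort_pos_alt sign_compose permutation_swap_id sign_swap_id)
  then show ?thesis
    by (simp only: signed_coeff_def hecke_def left_diff_distrib mult_1_left lookup_add lookup_minus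
        lookup_X_mult_add tdeg_add tdeg_single power_add power_one_right)
      (simp add: algebra_simps)
qed

lemma exponent_cases:
  obtains "Poly_Mapping.lookup m i = 0" | m' where "m = m' + Poly_Mapping.single i (1::nat)"
proof (cases "Poly_Mapping.lookup m i = 0")
  case False
  then have "m = (m - Poly_Mapping.single i 1) + Poly_Mapping.single i 1"
    by (intro poly_mapping_eqI) (auto simp: lookup_add lookup_minus lookup_single when_def)
  then show ?thesis by (rule that(2))
qed (rule that(1))

lemma signed_coeff_hecke_ge:
  assumes "sign_coherent F" "permutation p"
  shows "signed_coeff F p m \<le> signed_coeff (hecke j (X i) F) p m"
proof (cases "p (Suc j) < p j")
  case True
  show ?thesis
  proof (rule exponent_cases[of m i])
    fix m' assume "m = m' + Poly_Mapping.single i 1"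
    then show ?thesis
      using signed_coeff_hecke_add[OF assms(2) True, of i F m'] sign_coherentD[OF assms(1)] assms(2)
        permutation_sort_pos[OF assms(2)] by (simp add: add_nonneg_nonneg)
  qed (simp add: signed_coeff_hecke_zero)
next
  case False
  then show ?thesis by (simp add: signed_coeff_def hecke_no_descent)
qed

lemma sign_coherent_hecke: "sign_coherent F \<Longrightarrow> sign_coherent (hecke j (X i) F)"
  unfolding sign_coherent_def[of "hecke j (X i) F"]
  using signed_coeff_hecke_ge sign_coherentD order_trans by blast

lemma sign_coherent_row: "sign_coherent F \<Longrightarrow> sign_coherent (row i k (X i) F)"
proof (induction k)
  case (Suc k)
  then show ?case by (cases "i \<le> k") (simp_all add: row_last sign_coherent_hecke)
qed simp

lemma sign_coherent_groth_family: "sign_coherent (groth_family n i)"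
proof -
  have "sign_coherent (rows n js unit_family)" for js
  proof (induction js)
    case Nil
    then show ?case
      by (auto simp: sign_coherent_def signed_coeff_def unit_family_def lookup_one when_def
          tdeg_def)
  qed (simp add: sign_coherent_row)
  then show ?thesis by (simp add: groth_family_def)
qed

lemma hecke_keeps:
  assumes "sign_coherent F" "permutation p" "Poly_Mapping.lookup (F p) m \<noteq> 0"
  shows "Poly_Mapping.lookup (hecke j (X i) F p) m \<noteq> 0"
  using assms signed_coeff_hecke_ge[OF assms(1,2), of m j i] sign_coherentD[OF assms(1,2), of m]
  by (simp flip: signed_coeff_neq_0)

lemma hecke_gains:
  assumes "sign_coherent F" "permutation p" "p (Suc j) < p j"
    and "Poly_Mapping.lookup (F p) m \<noteq> 0 \<or> Poly_Mapping.lookup (F (sort_pos j p)) m \<noteq> 0"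
  shows "Poly_Mapping.lookup (hecke j (X i) F p) (m + Poly_Mapping.single i 1) \<noteq> 0"
  using assms(4) signed_coeff_hecke_add[OF assms(2,3), of i F m]
    sign_coherentD[OF assms(1,2), of m]
    sign_coherentD[OF assms(1,2), of "m + Poly_Mapping.single i 1"]
    sign_coherentD[OF assms(1) permutation_sort_pos[OF assms(2)], of j m]
  by (auto simp flip: signed_coeff_neq_0)

lemma row_keeps:
  assumes "sign_coherent F" "permutation p" "Poly_Mapping.lookup (row i k (X i) F p) m \<noteq> 0"
    and "i \<le> k" "k \<le> l"
  shows "Poly_Mapping.lookup (row i l (X i) F p) m \<noteq> 0"
  using assms(5,3)
proof (induction l rule: dec_induct)
  case (step l)
  then show ?case
    using assms(1,2,4) by (simp add: row_last hecke_keeps sign_coherent_row)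
qed

section \<open>Increasing subsequences\<close>

lemma length_le_rajcode_bar:
  "\<alpha> \<in> inc_seqs n w k \<Longrightarrow> length \<alpha> \<le> Suc (rajcode_bar n w k)"
  unfolding rajcode_bar_def using Max_ge[of "length ` inc_seqs n w k" "length \<alpha>"] finite_inc_seqs
  by fastforce

lemma rajcode_bar_attained:
  assumes "k \<in> {1..n}"
  obtains \<alpha> where "\<alpha> \<in> inc_seqs n w k" "length \<alpha> = Suc (rajcode_bar n w k)"
proof -
  note ne = invcode_le_rajcode(1,2)[OF assms, of w]
  from Max_in[OF _ ne(1)]
    obtain \<alpha> where "\<alpha> \<in> inc_seqs n w k" "Max (length ` inc_seqs n w k) = length \<alpha>"
    using finite_inc_seqs by auto
  then show ?thesis using ne(2) by (intro that[of \<alpha>]) (simp_all add: rajcode_bar_def)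
qed

lemma rajcode_bar_less:
  assumes "1 \<le> k" "k < k'" "k' \<le> n" "w k < w k'"
  shows "rajcode_bar n w k' < rajcode_bar n w k"
proof -
  obtain \<alpha> where \<alpha>: "\<alpha> \<in> inc_seqs n w k'" "length \<alpha> = Suc (rajcode_bar n w k')"
    using assms by (auto intro: rajcode_bar_attained[of k' n w])
  have "k # \<alpha> \<in> inc_seqs n w k"
    using \<alpha>(1) assms by (cases \<alpha>) (auto simp: inc_seqs_def)
  from length_le_rajcode_bar[OF this] show ?thesis using \<alpha>(2) by simp
qed

lemma rajcode_bar_cases:
  assumes "k \<in> {1..n}"
  shows "rajcode_bar n w k = 0 \<or>
    (\<exists>k'\<in>{k<..n}. w k < w k' \<and> rajcode_bar n w k = Suc (rajcode_bar n w k'))"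
proof -
  obtain \<alpha> where \<alpha>: "\<alpha> \<in> inc_seqs n w k" "length \<alpha> = Suc (rajcode_bar n w k)"
    using assms by (rule rajcode_bar_attained)
  then obtain \<beta> where \<beta>: "\<alpha> = k # \<beta>" by (cases \<alpha>) (auto simp: inc_seqs_def)
  show ?thesis
  proof (cases \<beta>)
    case Nil
    then show ?thesis using \<alpha> \<beta> by simp
  next
    case (Cons k' \<gamma>)
    have "\<beta> \<in> inc_seqs n w k'" "k < k'" "w k < w k'"
      using \<alpha>(1) by (auto simp: inc_seqs_def \<beta> Cons)
    moreover from this inc_seqs_bound(2) have "k' \<le> n" by blast
    moreover have "rajcode_bar n w k \<le> Suc (rajcode_bar n w k')"
      using length_le_rajcode_bar[OF \<open>\<beta> \<in> _\<close>] \<alpha>(2) by (simp add: \<beta>)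
    moreover have "rajcode_bar n w k' < rajcode_bar n w k"
      using calculation assms by (intro rajcode_bar_less) auto
    ultimately show ?thesis by (intro disjI2 bexI[of _ k']) auto
  qed
qed

text \<open>The two conditions bound \<open>f\<close> from below and from above by the longest
  increasing subsequences. Two permutations can thus be compared without handling sequences.\<close>

lemma rajcode_bar_unique:
  assumes "1 \<le> i"
    and less: "\<And>k k'. i \<le> k \<Longrightarrow> k < k' \<Longrightarrow> k' \<le> n \<Longrightarrow> v k < v k' \<Longrightarrow> f k' < f k"
    and cases: "\<And>k. k \<in> {i..n} \<Longrightarrow>
      f k = 0 \<or> (\<exists>k'\<in>{k<..n}. v k < v k' \<and> f k = Suc (f k'))"
    and "k \<in> {i..n}"
  shows "rajcode_bar n v k = f k"
  using assms(4)
proof (induction "n - k" arbitrary: k rule: less_induct)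
  case less
  have IH: "rajcode_bar n v k' = f k'" if "k' \<in> {k<..n}" for k'
    using that less.prems by (intro less.hyps) auto
  have "rajcode_bar n v k \<le> f k"
    using rajcode_bar_cases[of k n v] less.prems assms(1) IH assms(2)[of k] by fastforce
  moreover have "f k \<le> rajcode_bar n v k"
  proof (cases "f k = 0")
    case False
    then obtain k' where "k' \<in> {k<..n}" "v k < v k'" "f k = Suc (f k')"
      using cases[OF less.prems] by auto
    then show ?thesis
      using rajcode_bar_less[of k k' n v] less.prems assms(1) IH[of k'] by simp
  qed simp
  ultimately show ?case by simp
qed

lemma rajcode_bar_order_cong:
  assumes "1 \<le> i"
    and "\<And>k k'. i \<le> k \<Longrightarrow> k < k' \<Longrightarrow> k' \<le> n \<Longrightarrow> v k < v k' \<longleftrightarrow> w k < w k'"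
    and "k \<in> {i..n}"
  shows "rajcode_bar n v k = rajcode_bar n w k"
proof (rule rajcode_bar_unique[OF assms(1) _ _ assms(3)])
  show "rajcode_bar n w k' < rajcode_bar n w k" if "i \<le> k" "k < k'" "k' \<le> n" "v k < v k'" for k k'
    using that assms(1,2) by (intro rajcode_bar_less) auto
  show "rajcode_bar n w k = 0 \<or>
      (\<exists>k'\<in>{k<..n}. v k < v k' \<and> rajcode_bar n w k = Suc (rajcode_bar n w k'))"
    if "k \<in> {i..n}" for k
    using that assms(1,2) rajcode_bar_cases[of k n w] by fastforce
qed

lemma rajcode_bar_drop_first:
  assumes "w permutes {i..n}" "k \<in> {Suc i..n}"
  shows "rajcode_bar n (drop_first i w) k = rajcode_bar n w k"
  by (rule rajcode_bar_order_cong[of "Suc i"]) (use assms in \<open>auto simp: drop_first_less_iff\<close>)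

lemma invcode_drop_first:
  assumes "w permutes {i..n}" "k \<in> {Suc i..n}"
  shows "invcode n (drop_first i w) k = invcode n w k"
  unfolding invcode_def
  by (rule arg_cong[of _ _ card]) (use assms in \<open>auto simp: drop_first_less_iff\<close>)

text \<open>All of the values \<open>i, ..., w i - 1\<close> stand after position \<open>i\<close>,
  the first one that \<open>w\<close> may move.\<close>

lemma invcode_first:
  assumes w: "w permutes {i..n}" and "i \<le> n"
  shows "invcode n w i = w i - i"
proof -
  have eq: "w ` {j \<in> {i<..n}. w j < w i} = {i..<w i}"
  proof safe
    fix j assume "j \<in> {i<..n}" "w j < w i"
    then show "w j \<in> {i..<w i}" using permutes_interval[OF w, of j] by simp
  next
    fix y assume y: "y \<in> {i..<w i}"
    then have "y \<in> {i..n}" using permutes_interval[OF w, of i] assms(2) by simp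
    then have "inv w y \<in> {i..n}" using permutes_in_image[OF permutes_inv[OF w]] by blast
    moreover have "w (inv w y) = y" using w by (rule permutes_inverses)
    moreover have "inv w y \<noteq> i" using y calculation(2) by auto
    ultimately show "y \<in> w ` {j \<in> {i<..n}. w j < w i}" using y
      by (intro image_eqI[of _ _ "inv w y"]) auto
  qed
  have "card (w ` {j \<in> {i<..n}. w j < w i}) = invcode n w i"
    unfolding invcode_def by (rule card_image) (simp add: inj_on_def permutes_eq_iff[OF w])
  then show ?thesis unfolding eq by simp
qed

text \<open>The exchange changes only the comparison of positions \<open>q\<close> and
  \<open>p\<close>, which become an increasing pair; \<open>gt\<close> is the strict decrease that
  such a pair demands.\<close>

lemma rajcode_bar_swap:
  assumes w: "w permutes S" and "1 \<le> i" and qp: "q < p" "w p = K" "w q = Suc K"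
    and gt: "rajcode_bar n w p < rajcode_bar n w q" and "k \<in> {i..n}"
  shows "rajcode_bar n (transpose K (Suc K) \<circ> w) k = rajcode_bar n w k"
proof (rule rajcode_bar_unique[OF assms(2) _ _ assms(7)])
  have w_eq: "x = p \<longleftrightarrow> w x = K" "x = q \<longleftrightarrow> w x = Suc K" for x
    using permutes_eq_iff[OF w] qp by metis+
  have iff: "(transpose K (Suc K) \<circ> w) k < (transpose K (Suc K) \<circ> w) k' \<longleftrightarrow> w k < w k'"
    if "k < k'" "(k, k') \<noteq> (q, p)" for k k'
    unfolding comp_def
  proof (rule transpose_less_iff)
    show "w k \<noteq> w k'" using that by (simp add: permutes_eq_iff[OF w])
    then show "\<not> {w k, w k'} \<subseteq> {K, Suc K}" using that qp(1) by (auto simp flip: w_eq)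
  qed
  show "rajcode_bar n w k' < rajcode_bar n w k"
    if "i \<le> k" "k < k'" "k' \<le> n"
      "(transpose K (Suc K) \<circ> w) k < (transpose K (Suc K) \<circ> w) k'" for k k'
  proof (cases "(k, k') = (q, p)")
    case False
    then show ?thesis using that iff assms(2) by (intro rajcode_bar_less) auto
  qed (use gt in auto)
  show "rajcode_bar n w k = 0 \<or> (\<exists>k'\<in>{k<..n}.
      (transpose K (Suc K) \<circ> w) k < (transpose K (Suc K) \<circ> w) k' \<and>
      rajcode_bar n w k = Suc (rajcode_bar n w k'))"
    if k: "k \<in> {i..n}" for k
  proof (cases "rajcode_bar n w k = 0")
    case False
    then obtain k' where k': "k' \<in> {k<..n}" "w k < w k'" "rajcode_bar n w k =
        Suc (rajcode_bar n w k')"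
      using rajcode_bar_cases[of k n w] k assms(2) by auto
    then have "(k, k') \<noteq> (q, p)" using qp by auto
    then show ?thesis using k' iff[of k k'] by auto
  qed simp
qed

section \<open>Monomials in the support\<close>

lemma lookup_X_power_mult_add:
  "Poly_Mapping.lookup (X i ^ c * f) (m + Poly_Mapping.single i c) = Poly_Mapping.lookup f m"
proof (induction c)
  case (Suc c)
  have "m + Poly_Mapping.single i (Suc c) = (m + Poly_Mapping.single i c) + Poly_Mapping.single i 1"
    by (simp add: add.assoc flip: single_add)
  then show ?case
    using Suc lookup_X_mult_add[of i "X i ^ c * f" "m + Poly_Mapping.single i c"]
    by (simp add: mult.assoc)
qed simp

lemma permutes_imp_permutation_inv: "w permutes {i..n::nat} \<Longrightarrow> permutation (inv w)"
  using permutation_permutes permutes_inv by blast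

section \<open>Exponents reached by a single row\<close>

lemma row_lookup_invcode:
  assumes "sign_coherent F" "\<And>p. p i \<noteq> i \<Longrightarrow> F p = 0"
    and w: "w permutes {i..n}" "i \<le> n" "w i \<le> K"
    and m: "Poly_Mapping.lookup (F (inv (drop_first i w))) m \<noteq> 0"
  shows "Poly_Mapping.lookup (row i K (X i) F (inv w)) (m + Poly_Mapping.single i (w i - i)) \<noteq> 0"
proof (rule row_keeps[OF assms(1) permutes_imp_permutation_inv[OF w(1)] _ _ w(3)])
  show "i \<le> w i" using permutes_interval[OF w(1), of i] w(2) by simp
  show "Poly_Mapping.lookup (row i (w i) (X i) F (inv w)) (m + Poly_Mapping.single i (w i - i)) \<noteq> 0"
    using m by (simp add: row_first_value[OF w(1,2) assms(2)] lookup_X_power_mult_add)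
qed

text \<open>
  The bound on \<open>t\<close> is an invariant of the induction on \<open>K\<close>: for \<open>K = a + 1\<close> it forces \<open>t = 0\<close>, and
  for \<open>K = n\<close>, where \<open>R (inv w n) = 0\<close>, it allows every exponent of \<open>x\<^sub>i\<close> up to \<open>rajcode(w)\<^sub>i\<close>.
\<close>

lemma row_lookup:
  assumes F: "sign_coherent F" "\<And>p. p i \<noteq> i \<Longrightarrow> F p = 0" and i: "1 \<le> i" "i \<le> n"
    and m: "\<And>v. v permutes {Suc i..n} \<Longrightarrow> (\<And>k. k \<in> {Suc i..n} \<Longrightarrow> rajcode_bar n v k = R k) \<Longrightarrow>
      Poly_Mapping.lookup (F (inv v)) m \<noteq> 0"
    and "w permutes {i..n}" "w i = a" "\<And>k. k \<in> {i..n} \<Longrightarrow> rajcode_bar n w k = R k"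
    and "Suc a \<le> K" "K \<le> n" "t + R i + a \<le> K + R (inv w K)"
  shows "Poly_Mapping.lookup (row i K (X i) F (inv w)) (m + Poly_Mapping.single i (a - i + t)) \<noteq> 0"
  using assms(9,10,6-8,11)
proof (induction K arbitrary: w t rule: dec_induct)
  case base
  note w = base.prems(2)
  define q where "q = inv w (Suc a)"
  have wq: "w q = Suc a" unfolding q_def using w by (rule permutes_inverses)
  have "q \<noteq> i" using wq base.prems(3) by auto
  moreover have "q \<in> {i..n}" unfolding q_def
    using permutes_in_image[OF permutes_inv[OF w], of "Suc a"] base.prems
      permutes_interval[OF w, of i] i by simp
  ultimately have "R q < R i"
    using rajcode_bar_less[of i q n w] i wq base.prems(3,4) by simp
  \<comment> \<open>The invariant gives \<open>t + R i\<close> at most \<open>1 + R q\<close>, which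
    is at most \<open>R i\<close>.\<close>
  then have "t = 0" using base.prems(5) by (simp add: q_def)
  have "Poly_Mapping.lookup (F (inv (drop_first i w))) m \<noteq> 0"
    using base.prems(4) i
    by (intro m drop_first_permutes w) (simp_all add: rajcode_bar_drop_first[OF w])
  from row_lookup_invcode[OF F w i(2) _ this, of "Suc a"] show ?case
    using base.prems(3) \<open>t = 0\<close> by simp
next
  case (step K)
  note w = step.prems(2)
  define p q where "p = inv w K" and "q = inv w (Suc K)"
  have wp: "w p = K" and wq: "w q = Suc K"
    unfolding p_def q_def using w by (rule permutes_inverses)+
  have a: "i \<le> a" using permutes_interval[OF w, of i] i step.prems(3) by simp
  have pq: "p \<in> {i..n}" "q \<in> {i..n}" unfolding p_def q_def
    using permutes_in_image[OF permutes_inv[OF w]] step.prems(1) step.hyps a by simp_all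
  have "p \<noteq> q" using wp wq by auto
  have coh: "sign_coherent (row i K (X i) F)" using F(1) by (rule sign_coherent_row)
  have perm: "permutation (inv w)" using w by (rule permutes_imp_permutation_inv)
  have row: "row i (Suc K) (X i) F = hecke K (X i) (row i K (X i) F)"
    using a step.hyps by (simp add: row_last)
  show ?case
  proof (cases t)
    case 0
    have "Poly_Mapping.lookup (F (inv (drop_first i w))) m \<noteq> 0"
      using step.prems(4) i
      by (intro m drop_first_permutes w) (simp_all add: rajcode_bar_drop_first[OF w])
    from row_lookup_invcode[OF F w i(2) _ this, of "Suc K"] show ?thesis
      using step.prems(3) step.hyps 0 by simp
  next
    case (Suc t')
    show ?thesis
    proof (cases "p < q")
      case True
      \<comment> \<open>This factor cannot contribute, but the growth from \<open>R q\<close> to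
        \<open>R p\<close> makes up for lowering \<open>Suc K\<close> to \<open>K\<close> in the
        invariant.\<close>
      then have "R q < R p"
        using rajcode_bar_less[of p q n w] pq i wp wq step.prems(4) by simp
      then have "Poly_Mapping.lookup (row i K (X i) F (inv w))
          (m + Poly_Mapping.single i (a - i + t)) \<noteq> 0"
        using step.prems by (intro step.IH) (auto simp: p_def q_def)
      then show ?thesis unfolding row by (rule hecke_keeps[OF coh perm])
    next
      case False
      then have "q < p" using \<open>p \<noteq> q\<close> by simp
      let ?m = "m + Poly_Mapping.single i (a - i + t')"
      have m_eq: "m + Poly_Mapping.single i (a - i + t) = ?m + Poly_Mapping.single i 1"
        by (simp add: Suc add.assoc flip: single_add)
      have "Poly_Mapping.lookup (row i K (X i) F (inv w)) ?m \<noteq> 0 \<or>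
        Poly_Mapping.lookup (row i K (X i) F (sort_pos K (inv w))) ?m \<noteq> 0"
      proof (cases "R p < R q")
        case True
        \<comment> \<open>Exchanging the values leaves \<open>R\<close> intact and keeps
          \<open>q\<close> as the current position, so \<open>t\<close> and \<open>K\<close> both
          drop by one.\<close>
        let ?v = "transpose K (Suc K) \<circ> w"
        have inv_w: "sort_pos K (inv w) = inv ?v"
          using \<open>q < p\<close> permutes_bij[OF w]
            by (simp add: sort_pos_alt inv_transpose_comp p_def q_def)
        have v: "?v permutes {i..n}"
          using a step.hyps step.prems(1) by (intro permutes_compose[OF w] permutes_swap_id) auto
        have R: "rajcode_bar n ?v k = R k" if "k \<in> {i..n}" for k
          using rajcode_bar_swap[OF w i(1) \<open>q < p\<close> wp wq _ that] True pq step.prems(4) that by simp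
        have inv_v: "inv ?v K = q"
          by (simp add: inv_transpose_comp permutes_bij[OF w] q_def)
        have "Poly_Mapping.lookup (row i K (X i) F (inv ?v)) ?m \<noteq> 0"
        proof (rule step.IH[OF _ v _ R])
          show "t' + R i + a \<le> K + R (inv ?v K)"
            using step.prems(5) Suc unfolding inv_v by (simp add: q_def)
        qed (use step.prems step.hyps in \<open>auto simp: transpose_def\<close>)
        then show ?thesis unfolding inv_w by blast
      next
        case False
        \<comment> \<open>Without an exchange the current position becomes \<open>p\<close>, where
          \<open>R p\<close> is at least \<open>R q\<close>; again \<open>t\<close> and
          \<open>K\<close> both drop by one.\<close>
        then have "Poly_Mapping.lookup (row i K (X i) F (inv w)) ?m \<noteq> 0"
          using step.prems Suc by (intro step.IH) (auto simp: p_def q_def)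
        then show ?thesis by blast
      qed
      then show ?thesis
        unfolding row m_eq using \<open>q < p\<close>
          by (intro hecke_gains[OF coh perm]) (simp_all add: p_def q_def)
    qed
  qed
qed

text \<open>The shape of every vector \<open>L n w s\<close>, relative to the positions from
  \<open>i\<close> on. The index \<open>k\<close> may lie outside \<open>{i..n}\<close>, which
  leaves only one of the two codes.\<close>

definition transitional :: "nat \<Rightarrow> (nat \<Rightarrow> nat) \<Rightarrow> nat \<Rightarrow> (nat \<Rightarrow> nat) \<Rightarrow> nat \<Rightarrow> bool" where
  "transitional n w i c k \<longleftrightarrow> (\<forall>p\<in>{i..n}. (p < k \<longrightarrow> c p = invcode n w p) \<and>
     (p = k \<longrightarrow> invcode n w p \<le> c p \<and> c p \<le> rajcode n w p) \<and> (k < p \<longrightarrow> c p = rajcode n w p))"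

lemma groth_family_lookup:
  assumes "1 \<le> i" "i \<le> Suc n" "w permutes {i..n}" "transitional n w i c k"
  shows "Poly_Mapping.lookup (groth_family n i (inv w)) (\<Sum>p=i..n. Poly_Mapping.single p (c p)) \<noteq> 0"
  using assms(2,1,3,4)
proof (induction i arbitrary: w k rule: inc_induct)
  case base
  then have "w = id" by simp
  then show ?case by (simp add: groth_family_beyond unit_family_def lookup_one fun_eq_iff)
next
  case (step i)
  note w = step.prems(2) and c = step.prems(3)
  let ?m = "\<Sum>p=Suc i..n. Poly_Mapping.single p (c p)"
  have i: "1 \<le> i" "i \<le> n" using step by auto
  have a: "i \<le> w i" "w i \<le> n" using permutes_interval[OF w, of i] i by auto
  have F: "sign_coherent (groth_family n (Suc i))" "\<And>p. p i \<noteq> i \<Longrightarrow> groth_family n (Suc i) p = 0"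
    by (simp_all add: sign_coherent_groth_family groth_family_zero[of i])
  have sum: "(\<Sum>p=i..n. Poly_Mapping.single p (c p)) = ?m + Poly_Mapping.single i (c i)"
    using i by (simp add: sum.atLeast_Suc_atMost add.commute)
  note code = invcode_first[OF w i(2)] invcode_le_rajcode(3,4)[of i n w]
  have raj: "rajcode n (drop_first i w) p = rajcode n w p" if "p \<in> {Suc i..n}" for p
    using rajcode_bar_drop_first[OF w that] by (simp add: rajcode_def)
  have "transitional n (drop_first i w) (Suc i) c k"
    using c by (auto simp: transitional_def raj invcode_drop_first[OF w])
  with step.IH[OF _ drop_first_permutes[OF w i(2)]]
  have drop: "Poly_Mapping.lookup (groth_family n (Suc i) (inv (drop_first i w))) ?m \<noteq> 0" by simp
  show ?case
  proof (cases "c i = w i - i")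
    case True
    then show ?thesis
      using row_lookup_invcode[OF F w i(2) a(2) drop] by (simp add: groth_family_step[of n i] sum)
  next
    case False
    have ci: "i < k \<Longrightarrow> c i = invcode n w i" "k < i \<Longrightarrow> c i = rajcode n w i"
      "k = i \<Longrightarrow> invcode n w i \<le> c i \<and> c i \<le> rajcode n w i"
      using c i by (auto simp: transitional_def)
    \<comment> \<open>All exponents after \<open>i\<close> are therefore values of
      \<open>rajcode\<close>. They depend only on \<open>rajcode_bar\<close>, so the induction
      hypothesis covers every \<open>v\<close> that the exchanges in this row can produce.\<close>
    have k: "k \<le> i" using ci(1) False code(1) by (cases "i < k") auto
    have "w i - i \<le> c i" "c i \<le> rajcode n w i"
      using k ci(2,3) code i by (cases "k = i"; auto)+
    define t where "t = c i - (w i - i)"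
    have t: "c i = w i - i + t" "0 < t" using False \<open>w i - i \<le> c i\<close> by (auto simp: t_def)
    have le: "t + rajcode_bar n w i + w i \<le> n"
      using \<open>c i \<le> rajcode n w i\<close> t a code(2) i by (simp add: rajcode_def)
    have "Poly_Mapping.lookup (row i n (X i) (groth_family n (Suc i)) (inv w))
        (?m + Poly_Mapping.single i (w i - i + t)) \<noteq> 0"
    proof (rule row_lookup[OF F i _ w, where R = "rajcode_bar n w"])
      fix v assume v: "v permutes {Suc i..n}"
        and R: "\<And>k. k \<in> {Suc i..n} \<Longrightarrow> rajcode_bar n v k = rajcode_bar n w k"
      have "transitional n v (Suc i) c i"
        using c k R by (auto simp: transitional_def rajcode_def)
      then show "Poly_Mapping.lookup (groth_family n (Suc i) (inv v)) ?m \<noteq> 0"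
        using step.IH v by simp
    qed (use le t in auto)
    then show ?thesis by (simp add: groth_family_step[of n i] sum t)
  qed
qed

text \<open>The sum is carried along because it shows that the maximum in the recursion is taken
  over a nonempty set.\<close>

lemma L_transitional:
  assumes "s \<le> raj n w - inv_number n w"
  shows "(\<exists>k. transitional n w 1 (L n w s) k) \<and> (\<Sum>j=1..n. L n w s j) = inv_number n w + s"
  using assms
proof (induction s)
  case 0
  \<comment> \<open>The witness \<open>Suc n\<close> puts every position before
    \<open>k\<close>.\<close>
  then show ?case by (auto simp: transitional_def inv_number_def intro!: exI[of _ "Suc n"])
next
  case (Suc s)
  let ?c = "L n w s"
  let ?J = "{j \<in> {1..n}. ?c j < rajcode n w j}"
  from Suc obtain k where k: "transitional n w 1 ?c k"
    and sum: "(\<Sum>j=1..n. ?c j) = inv_number n w + s" by auto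
  have le: "?c p \<le> rajcode n w p" if "p \<in> {1..n}" for p
    using k that invcode_le_rajcode(4)[OF that, of w]
    by (cases p k rule: linorder_cases) (auto simp: transitional_def)
  have "?J \<noteq> {}"
  proof
    assume "?J = {}"
    then have "raj n w \<le> (\<Sum>j=1..n. ?c j)" unfolding raj_def by (intro sum_mono) force
    then show False using sum Suc.prems by simp
  qed
  define j where "j = Max ?J"
  have j: "j \<in> {1..n}" "?c j < rajcode n w j"
    using Max_in[of ?J] \<open>?J \<noteq> {}\<close> by (auto simp: j_def)
  have above: "?c p = rajcode n w p" if "p \<in> {1..n}" "j < p" for p
    using Max_ge[of ?J p] that le[of p] by (fastforce simp: j_def)
  have L: "L n w (Suc s) = ?c(j := ?c j + 1)" by (simp add: j_def Let_def)
  have below: "?c p = invcode n w p" if "p \<in> {1..n}" "p < j" for p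
  proof -
    \<comment> \<open>If \<open>k\<close> were smaller than \<open>j\<close>, the entry at
      \<open>j\<close> would already equal \<open>rajcode n w j\<close>.\<close>
    have "j \<le> k" using j k by (auto simp: transitional_def not_le[symmetric])
    then show ?thesis using k that by (simp add: transitional_def)
  qed
  have "invcode n w j \<le> ?c j"
    using k j invcode_le_rajcode(4)[OF j(1), of w]
    by (cases j k rule: linorder_cases) (auto simp: transitional_def)
  then have "transitional n w 1 (L n w (Suc s)) j"
    using j(2) above below unfolding L by (auto simp: transitional_def)
  moreover have "(\<Sum>p=1..n. L n w (Suc s) p) = Suc (\<Sum>p=1..n. ?c p)"
    using j(1) unfolding L by (simp add: sum.remove[of _ j])
  ultimately show ?case using sum by auto
qed

theorem corollary9p10:
  fixes n d i :: nat and w :: "nat \<Rightarrow> nat"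
  assumes "w permutes {1..n}"
    and "d = raj n w - inv_number n w"
    and "i \<le> d"
  shows "Poly_Mapping.lookup (grothendieck n w) (expvec n (L n w i)) \<noteq> 0"
proof -
  obtain k where "transitional n w 1 (L n w i) k"
    using L_transitional assms(2,3) by blast
  from groth_family_lookup[OF _ _ assms(1) this] show ?thesis
    by (simp add: grothendieck_eq_groth_family[OF assms(1)] expvec_def)
qed

end
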